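(* Let $s,t>1$ be integers with $\gcd(s,t)=1$. For the positive torus knot $K=T(s,t)\subset S^3$, the series $F_K(x,q)$ is given by $$F_K(x,q)=q^{\frac{(s-1)(t-1)}2}\cdot\frac12\sum_{m\ge1}\varepsilon_m\cdot\bigl(x^{\frac m2}-x^{-\frac m2}\bigr)\,q^{\frac{m^2-(st-s-t)^2}{4st}},$$ where $$\varepsilon_m=\begin{cases}-1&\text{if } m\equiv st+s+t\ \text{or}\ st-s-t\pmod{2st},\\ +1&\text{if } m\equiv st+s-t\ \text{or}\ st-s+t\pmod{2st},\\ 0&\text{otherwise.}\end{cases}$$
   Context: Definition of $F_K$. Let $\Gamma$ be a finite tree with vertex set $\mathrm{Vert}$, $N=|\mathrm{Vert}|$, integer weights $m_v$, and a distinguished vertex $v_0$ of degree $1$. Its linking matrix $M$ has $M_{vv}=m_v$, $M_{uv}=1$ if $u\ne v$ are adjacent, $0$ otherwise; $\pi(M)$ is the number of positive eigenvalues, $\sigma(M)$ the signature (number of positive minus number of negative eigenvalues), $\vec\delta=(\deg v)_v$. Suppose $\hat\Gamma=\Gamma\setminus v_0$ is negative definite, that the associated plumbed 3-manifold $\hat Y=Y(\hat\Gamma)$ is an integer homology sphere, that $K\subset\hat Y$ is the knot given by the unknot component of $v_0$ in the surgery diagram of $\Gamma$, and that the framing $m_{v_0}$ of this component is the Seifert framing of $K$ (so $\det M=0$). Let $\mathbb Z^{N-1}\subset\mathbb Z^N$ be the vectors with $v_0$-entry $0$. The self-conjugate relative $\mathrm{Spin}^c$ structure corresponds to the class in $(2\mathbb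 Z^N+\vec\delta)/(2M\mathbb Z^{N-1})$ of a vector of the form $M\vec b$ with $\vec b\in\mathbb Z^{N-1}$ and $M\vec b\in2\mathbb Z^N+\vec\delta$. Then $$F_K(x,q)=(-1)^{\pi(M)}q^{\frac{3\sigma(M)-\sum_v m_v}{4}}\oint\prod_{v\ne v_0}\frac{dz_v}{2\pi i z_v}\Bigl(z_v-\frac1{z_v}\Bigr)^{2-\deg v}\sum_{\vec n}q^{-\frac{(2\vec n+\vec b,\,M(2\vec n+\vec b))}4}\prod_{v\in\mathrm{Vert}}z_v^{\ell_v},$$ where $\vec\ell=M(2\vec n+\vec b)$, $z_{v_0}=x^{1/2}$, and the sum is over $\vec n\in\mathbb Z^N$ with $n_{v_0}=n$ for a fixed $n\in\mathbb Z$ (the result is independent of $n$; take $n=0$). The integrals are principal values: $(z_v-1/z_v)^{2-\deg v}$ is replaced by the average of its Laurent expansions at $z_v\to0$ and $z_v\to\infty$, and one takes the constant coefficient in each $z_v$, $v\neq v_0$. Plumbing for $T(s,t)$. There are unique integers $t'\in(0,t)$, $s'\in(0,s)$ with $st'\equiv-1\pmod t$ and $ts'\equiv-1\pmod s$. The complement of $T(s,t)\subset S^3$ with Seifert framing is represented by the star-shaped tree with central vertex of weight $-1$ and three legs: two legs with weights $-k_1,-k_2,\dots$ (read outward from the centre) given by the continued fractions $\frac t{t'}=k_1-\cfrac1{k_2-\cdots}$, respectively $\frac s{s'}=k_1-\cfrac1{k_2-\cdots}$, with all weights negative (i.e. all $k_i\ge2$), and a third leg consisting only of the distinguished vertex $v_0$,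 of weight $-st$. *)

theory Defs
  imports
    "HOL-Computational_Algebra.Formal_Laurent_Series"
    "HOL-Number_Theory.Cong"
    "Jordan_Normal_Form.Char_Poly"
begin

section \<open>Formal series in rational powers of x and q\<close>

text \<open>A series \<open>S\<close> is given by its coefficients: \<open>S a e\<close> is the coefficient of \<open>x^a q^e\<close>.\<close>

type_synonym xq_series = "rat \<Rightarrow> rat \<Rightarrow> rat"

definition xq_monom :: "rat \<Rightarrow> rat \<Rightarrow> xq_series" where
  "xq_monom a e = (\<lambda>a' e'. if a' = a \<and> e' = e then 1 else 0)"

definition xq_scale :: "rat \<Rightarrow> xq_series \<Rightarrow> xq_series" where
  "xq_scale c S = (\<lambda>a e. c * S a e)"

text \<open>Multiplication by \<open>q^r\<close>.\<close>

definition q_shift :: "rat \<Rightarrow> xq_series \<Rightarrow> xq_series" where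
  "q_shift r S = (\<lambda>a e. S a (e - r))"

text \<open>The sum of a family of series, taken coefficientwise.  It is meaningful for families in
  which only finitely many members contribute to any given coefficient.\<close>

definition formal_sum :: "'i set \<Rightarrow> ('i \<Rightarrow> xq_series) \<Rightarrow> xq_series" where
  "formal_sum I f = (\<lambda>a e. \<Sum>i\<in>{i\<in>I. f i a e \<noteq> 0}. f i a e)"

section \<open>Eigenvalue counts of real matrices\<close>

text \<open>Eigenvalues are counted with multiplicity.\<close>

definition num_pos_eigenvalues :: "real mat \<Rightarrow> nat" where
  "num_pos_eigenvalues A = (\<Sum>x\<in>{x. eigenvalue A x \<and> x > 0}. order x (char_poly A))"

definition num_neg_eigenvalues :: "real mat \<Rightarrow> nat" where
  "num_neg_eigenvalues A = (\<Sum>x\<in>{x. eigenvalue A x \<and> x < 0}. order x (char_poly A))"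

definition matrix_signature :: "real mat \<Rightarrow> int" where
  "matrix_signature A = int (num_pos_eigenvalues A) - int (num_neg_eigenvalues A)"

definition negative_definite :: "real mat \<Rightarrow> bool" where
  "negative_definite A \<longleftrightarrow>
     (\<forall>x\<in>carrier_vec (dim_row A). x \<noteq> 0\<^sub>v (dim_row A) \<longrightarrow> x \<bullet> (A *\<^sub>v x) < 0)"

section \<open>Principal values\<close>

text \<open>The constant coefficient in \<open>z\<close> of \<open>z^l (z - 1/z)^p\<close>, where the second factor is
  replaced by the average of its Laurent expansions at \<open>z = 0\<close> and at \<open>z = \<infinity>\<close>.  The
  expansion at infinity is a Laurent series in \<open>w = 1/z\<close>, in which \<open>z - 1/z\<close> is \<open>1/w - w\<close>
  and \<open>z^l\<close> is \<open>w^(-l)\<close>.\<close>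

definition pv_const_coeff :: "int \<Rightarrow> int \<Rightarrow> rat" where
  "pv_const_coeff p l =
     (fls_nth (fls_X_intpow l * (fls_X - fls_X_inv) powi p) 0
      + fls_nth (fls_X_intpow (- l) * (fls_X_inv - fls_X) powi p) 0) / 2"

section \<open>Plumbing graphs with a distinguished vertex\<close>

text \<open>The vertices are the numbers below the length of the list of weights; an edge is a
  two-element set of vertices.\<close>

record plumbing_graph =
  weights :: "int list"
  edges :: "nat set set"
  marked :: nat

definition num_verts :: "plumbing_graph \<Rightarrow> nat" where
  "num_verts G = length (weights G)"

definition verts :: "plumbing_graph \<Rightarrow> nat set" where
  "verts G = {..<num_verts G}"

definition degree_at :: "plumbing_graph \<Rightarrow> nat \<Rightarrow> nat" where
  "degree_at G v = card {e \<in> edges G. v \<in> e}"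

definition is_tree :: "plumbing_graph \<Rightarrow> bool" where
  "is_tree G \<longleftrightarrow>
     (\<forall>e\<in>edges G. e \<subseteq> verts G \<and> card e = 2) \<and>
     (\<forall>u\<in>verts G. \<forall>v\<in>verts G. (u, v) \<in> {(a, b). {a, b} \<in> edges G}\<^sup>*) \<and>
     card (edges G) + 1 = num_verts G"

definition linking_matrix :: "plumbing_graph \<Rightarrow> int mat" where
  "linking_matrix G = mat (num_verts G) (num_verts G)
     (\<lambda>(u, v). if u = v then weights G ! v else if {u, v} \<in> edges G then 1 else 0)"

text \<open>The linking matrix of the graph with the distinguished vertex removed.\<close>

definition reduced_matrix :: "plumbing_graph \<Rightarrow> int mat" where
  "reduced_matrix G = mat_delete (linking_matrix G) (marked G) (marked G)"

text \<open>The standing assumptions under which \<open>F_K\<close> is defined.  The first homology of the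
  3-manifold plumbed along the graph without the distinguished vertex is the cokernel of the
  reduced matrix, so this manifold is an integer homology sphere iff the determinant of the
  reduced matrix is a unit; the framing of the distinguished vertex is then the Seifert framing
  of the knot iff the full linking matrix is singular.\<close>

locale plumbed_knot =
  fixes G :: plumbing_graph
  assumes tree: "is_tree G"
    and marked_vertex: "marked G \<in> verts G"
    and marked_degree: "degree_at G (marked G) = 1"
    and reduced_negative_definite:
      "negative_definite (map_mat real_of_int (reduced_matrix G))"
    and homology_sphere: "\<bar>det (reduced_matrix G)\<bar> = 1"
    and Seifert_framing: "det (linking_matrix G) = 0"
begin

text \<open>The integer vectors whose entry at the distinguished vertex is 0.\<close>

definition unmarked_lattice :: "int vec set" where
  "unmarked_lattice = {n \<in> carrier_vec (num_verts G). vec_index n (marked G) = 0}"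

text \<open>A vector \<open>b\<close> such that \<open>M b\<close> represents the self-conjugate relative
  \<open>Spin^c\<close> structure.  Since the reduced matrix is invertible modulo 2, two such vectors differ
  by twice an element of the unmarked lattice, so the choice does not affect \<open>F_K\<close>.\<close>

definition self_conjugate_vec :: "int vec" where
  "self_conjugate_vec = (SOME b. b \<in> unmarked_lattice \<and>
     (\<forall>v\<in>verts G. [vec_index (linking_matrix G *\<^sub>v b) v = int (degree_at G v)] (mod 2)))"

text \<open>The integrand is a sum over \<open>n\<close> of monomials in \<open>q\<close> and the \<open>z_v\<close>, where \<open>z_v\<close> is
  \<open>x^(1/2)\<close> at the distinguished vertex.  The constant coefficient is taken term by term; by
  negative definiteness only finitely many \<open>n\<close> contribute to a given power of \<open>q\<close>.\<close>

definition F_K :: xq_series where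
  "F_K =
    (let M = linking_matrix G;
         MR = map_mat real_of_int M
     in xq_scale ((- 1) ^ num_pos_eigenvalues MR)
         (q_shift (of_int (3 * matrix_signature MR - sum_list (weights G)) / 4)
           (formal_sum unmarked_lattice (\<lambda>n.
              let y = 2 \<cdot>\<^sub>v n + self_conjugate_vec;
                  l = M *\<^sub>v y
              in xq_scale
                  (\<Prod>v\<in>verts G - {marked G}.
                     pv_const_coeff (2 - int (degree_at G v)) (vec_index l v))
                  (xq_monom (of_int (vec_index l (marked G)) / 2) (- of_int (y \<bullet> l) / 4))))))"

end

section \<open>The plumbing graph of a torus knot\<close>

fun neg_cont_frac :: "int list \<Rightarrow> rat" where
  "neg_cont_frac [] = 0"
| "neg_cont_frac [k] = of_int k"
| "neg_cont_frac (k # k' # ks) = of_int k - 1 / neg_cont_frac (k' # ks)"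

text \<open>The entries \<open>k\<^sub>1, k\<^sub>2, \<dots>\<close> of the expansion of \<open>r > 1\<close> with all entries at
  least 2.\<close>

definition neg_cf_expansion :: "rat \<Rightarrow> int list" where
  "neg_cf_expansion r =
     (THE ks. ks \<noteq> [] \<and> (\<forall>k\<in>set ks. k \<ge> 2) \<and> neg_cont_frac ks = r)"

text \<open>For coprime \<open>s, t > 1\<close> this is \<open>t'\<close>, and with the arguments swapped it is \<open>s'\<close>.\<close>

definition neg_inverse_mod :: "int \<Rightarrow> int \<Rightarrow> int" where
  "neg_inverse_mod s t = (THE t'. 0 < t' \<and> t' < t \<and> [s * t' = - 1] (mod t))"

text \<open>Vertex 0 is the centre, the two legs occupy \<open>1, \<dots>, a\<close> and \<open>a+1, \<dots>, a+b\<close>, both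
  numbered outward from the centre, and \<open>a+b+1\<close> is the distinguished vertex.\<close>

definition torus_knot_plumbing :: "int \<Rightarrow> int \<Rightarrow> plumbing_graph" where
  "torus_knot_plumbing s t =
    (let ks = neg_cf_expansion (of_int t / of_int (neg_inverse_mod s t));
         ls = neg_cf_expansion (of_int s / of_int (neg_inverse_mod t s));
         a = length ks;
         b = length ls
     in \<lparr>weights = [- 1] @ map uminus ks @ map uminus ls @ [- (s * t)],
         edges = {{0, 1}, {0, a + 1}, {0, a + b + 1}}
           \<union> {{i, i + 1} | i. 1 \<le> i \<and> i < a}
           \<union> {{i, i + 1} | i. a + 1 \<le> i \<and> i < a + b},
         marked = a + b + 1\<rparr>)"

definition torus_eps :: "int \<Rightarrow> int \<Rightarrow> int \<Rightarrow> rat" where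
  "torus_eps s t m =
    (if [m = s * t + s + t] (mod (2 * s * t)) \<or> [m = s * t - s - t] (mod (2 * s * t)) then - 1
     else if [m = s * t + s - t] (mod (2 * s * t)) \<or> [m = s * t - s + t] (mod (2 * s * t)) then 1
     else 0)"

end

theory Submission
  imports Defs "HOL-Computational_Algebra.Fundamental_Theorem_Algebra"
begin

no_notation fps_nth (infixl \<open>$\<close> 75)

text \<open>The constant coefficient of the integrand vanishes unless \<open>\<ell> = M y\<close>, with \<open>y = 2n + b\<close>, is \<open>0\<close> at
  the interior leg vertices, \<open>\<epsilon>\<^sub>1, \<epsilon>\<^sub>2 \<in> {1, -1}\<close> at the two leaves and an odd number \<open>c\<close> at the centre.
  As the reduced matrix is unimodular, each triple \<open>(c, \<epsilon>\<^sub>1, \<epsilon>\<^sub>2)\<close> comes from exactly one \<open>n\<close>.  Eliminating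
  the legs by continued fractions and using \<open>s t' + t s' = st - 1\<close> gives
  \<open>y\<^sub>0 = - (stc + s\<epsilon>\<^sub>1 + t\<epsilon>\<^sub>2)\<close>, which is also the entry of \<open>\<ell>\<close> at the distinguished vertex, while
  \<open>(y, \<ell>)\<close> is \<open>- y\<^sub>0\<^sup>2 / (st)\<close> up to a constant, so \<open>m = |y\<^sub>0|\<close> indexes the terms of the series.
  The constant in the exponent of \<open>q\<close> amounts to Dedekind reciprocity for the two continued
  fractions, proved by blowing down.  Finally \<open>M\<close> has the positive kernel vector of multiplicities,
  which makes it negative semidefinite with one-dimensional kernel and determines \<open>\<pi>(M)\<close> and
  \<open>\<sigma>(M)\<close>.\<close>

section \<open>Negative continued fractions\<close>

text \<open>Since \<open>c\<close> is odd and \<open>s\<close>, \<open>t\<close> are coprime,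
  \<open>y\<^sub>0\<close> determines the triple. Fixing the exponent of x therefore isolates at
  most one summand on either side, and the two series can be compared coefficient by coefficient.
  The signs at the leaves drop out of the exponent of q because, once the form is written in
  \<open>y\<^sub>0\<close>, they enter only through their squares. As \<open>st > s + t\<close>, the
  sign of \<open>y\<^sub>0\<close> is opposite to that of \<open>c\<close>, so the sign produced by
  the principal value at the centre becomes the sign between x^(m/2) and x^(-m/2); the factor 1/2 is
  that of the same principal value. What remains in the exponent are the sums of the entries and
  \<open>cf_conum\<close>, the inverse of \<open>cf_den\<close> modulo \<open>cf_num\<close>, that
  is, data of Dedekind sum type of which only one combination is required. Eigenvalues are counted
  with algebraic multiplicity, so semidefiniteness alone does not give the signature: the
  characteristic polynomial must split over the reals and have 0 as a simple root.\<close>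

primrec chain :: "int \<Rightarrow> int \<Rightarrow> int list \<Rightarrow> int \<times> int" where
  "chain p r [] = (p, r)"
| "chain p r (k # ks) = (k * fst (chain p r ks) - snd (chain p r ks), fst (chain p r ks))"

text \<open>\<open>chain p r\<close> runs the recurrence z_i = k_(i+1) z_(i+1) - z_(i+2) towards the
  head, starting from the values \<open>p\<close>, \<open>r\<close> at the end. The start (1, 0)
  gives numerator and denominator of the fraction. The start (0, -1) gives the second fundamental
  solution, which for nonempty lists is the fraction with its last entry removed; its sign is chosen
  so that the Wronskian is 1.\<close>

abbreviation cf_num :: "int list \<Rightarrow> int" where "cf_num ks \<equiv> fst (chain 1 0 ks)"
abbreviation cf_den :: "int list \<Rightarrow> int" where "cf_den ks \<equiv> snd (chain 1 0 ks)"
abbreviation cf_conum :: "int list \<Rightarrow> int" where "cf_conum ks \<equiv> fst (chain 0 (- 1) ks)"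
abbreviation cf_coden :: "int list \<Rightarrow> int" where "cf_coden ks \<equiv> snd (chain 0 (- 1) ks)"

lemma chain_wronskian: "cf_conum ks * cf_den ks - cf_coden ks * cf_num ks = 1"
  by (induction ks) (auto simp: algebra_simps)

lemma chain_lincomb:
  "chain p r ks = (p * cf_num ks - r * cf_conum ks, p * cf_den ks - r * cf_coden ks)"
  by (induction ks) (auto simp: algebra_simps)

lemma cf_den_bounds:
  assumes "\<forall>k\<in>set ks. k \<ge> 2"
  shows "0 \<le> cf_den ks \<and> cf_den ks < cf_num ks"
  using assms
proof (induction ks)
  case (Cons k ks)
  then have "2 * cf_num ks \<le> k * cf_num ks" by (intro mult_right_mono) auto
  moreover have "0 \<le> cf_den ks" "cf_den ks < cf_num ks" using Cons by auto
  ultimately have "cf_num ks < k * cf_num ks - cf_den ks" by linarith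
  then show ?case using \<open>0 \<le> cf_den ks\<close> \<open>cf_den ks < cf_num ks\<close> by simp
qed simp

lemma cf_den_pos:
  assumes "\<forall>k\<in>set ks. k \<ge> 2" "ks \<noteq> []"
  shows "0 < cf_den ks"
  using cf_den_bounds[of "tl ks"] assms by (cases ks) auto

lemma neg_cont_frac_eq:
  assumes "\<forall>k\<in>set ks. k \<ge> 2" "ks \<noteq> []"
  shows "neg_cont_frac ks = of_int (cf_num ks) / of_int (cf_den ks)"
  using assms
proof (induction ks rule: neg_cont_frac.induct)
  case (3 k k' ks)
  have "cf_num (k' # ks) > 0" using cf_den_bounds[of "k' # ks"] 3 by auto
  moreover have "neg_cont_frac (k' # ks) = of_int (cf_num (k' # ks)) / of_int (cf_den (k' # ks))"
    using 3 by simp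
  moreover have "cf_num (k # k' # ks) = k * cf_num (k' # ks) - cf_den (k' # ks)"
    "cf_den (k # k' # ks) = cf_num (k' # ks)" by simp_all
  ultimately show ?case by (simp del: chain.simps add: diff_divide_distrib)
qed auto

lemma neg_cont_frac_gt_1:
  assumes "\<forall>k\<in>set ks. k \<ge> 2" "ks \<noteq> []"
  shows "neg_cont_frac ks > 1"
  using cf_den_bounds[OF assms(1)] cf_den_pos[OF assms] by (simp add: neg_cont_frac_eq[OF assms])

text \<open>The tail has value greater than 1, so it lowers the head by less than 1 and the head can
  be read off the value. This makes the expansion unique, as the definite description in
  \<open>neg_cf_expansion\<close> demands.\<close>

lemma neg_cont_frac_ceiling:
  assumes "\<forall>k\<in>set (k # ks). k \<ge> 2"
  shows "\<lceil>neg_cont_frac (k # ks)\<rceil> = k"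
proof (cases ks)
  case (Cons k' ks')
  have "neg_cont_frac (k' # ks') > 1" using assms Cons by (intro neg_cont_frac_gt_1) auto
  then show ?thesis unfolding Cons by (auto intro!: ceiling_unique simp: field_simps)
qed simp

lemma neg_cont_frac_Cons:
  "neg_cont_frac (k # ks) = (if ks = [] then of_int k else of_int k - 1 / neg_cont_frac ks)"
  by (cases ks) simp_all

lemma neg_cont_frac_inject:
  assumes "\<forall>k\<in>set ks. k \<ge> 2" "ks \<noteq> []" "\<forall>k\<in>set ls. k \<ge> 2" "ls \<noteq> []"
    and "neg_cont_frac ks = neg_cont_frac ls"
  shows "ks = ls"
  using assms
proof (induction ks arbitrary: ls)
  case (Cons k ks)
  obtain l ls' where ls: "ls = l # ls'" using Cons.prems by (cases ls) auto
  have kl: "k = l"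
    using neg_cont_frac_ceiling[of k ks] neg_cont_frac_ceiling[of l ls'] Cons.prems ls by simp
  have gt: "ks \<noteq> [] \<Longrightarrow> neg_cont_frac ks > 1" "ls' \<noteq> [] \<Longrightarrow> neg_cont_frac ls' > 1"
    using Cons.prems ls by (auto intro: neg_cont_frac_gt_1)
  have "(if ks = [] then 0 else 1 / neg_cont_frac ks) = (if ls' = [] then 0 else 1 / neg_cont_frac ls')"
    using Cons.prems(5) unfolding ls kl neg_cont_frac_Cons by (simp split: if_splits)
  then have "ks = [] \<and> ls' = [] \<or> ks \<noteq> [] \<and> ls' \<noteq> [] \<and> neg_cont_frac ks = neg_cont_frac ls'"
    using gt by (cases "ks = []"; cases "ls' = []") simp_all
  then show ?case
  proof
    assume *: "ks \<noteq> [] \<and> ls' \<noteq> [] \<and> neg_cont_frac ks = neg_cont_frac ls'"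
    then have "ks = ls'" using Cons.prems ls by (intro Cons.IH) simp_all
    then show ?thesis by (simp add: ls kl)
  qed (simp add: ls kl)
qed simp

lemma neg_cf_exists:
  fixes p q :: int
  assumes "0 < q" "q < p" "coprime p q"
  shows "\<exists>ks. ks \<noteq> [] \<and> (\<forall>k\<in>set ks. k \<ge> 2) \<and> cf_num ks = p \<and> cf_den ks = q"
  using assms
proof (induction "nat q" arbitrary: p q rule: less_induct)
  case less
  show ?case
  proof (cases "q = 1")
    case True
    then show ?thesis using less.prems by (intro exI[of _ "[p]"]) auto
  next
    case False
    \<comment> \<open>Euclidean division rounded up: \<open>k\<close> is the ceiling of p / q and
      \<open>r\<close> is the excess, which leads to p / q = k - 1 / (q / r).\<close>
    define r where "r = (- p) mod q"
    define k where "k = (p + r) div q"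
    have "q dvd p + r" unfolding r_def
      by (simp add: dvd_eq_mod_eq_0 mod_add_right_eq)
    then have p: "p = k * q - r" unfolding k_def by simp
    have "r \<noteq> 0"
    proof
      assume "r = 0"
      then have "q dvd p" using p by simp
      then have "is_unit q" using less.prems(3) by (meson coprime_common_divisor dvd_refl)
      then show False using False less.prems(1) by simp
    qed
    moreover have "0 \<le> r" "r < q" using less.prems(1) unfolding r_def by simp_all
    ultimately have r: "0 < r" "r < q" by simp_all
    have "coprime q r"
    proof (rule coprimeI)
      fix c assume "c dvd q" "c dvd r"
      then have "c dvd p" unfolding p by (intro dvd_diff dvd_mult)
      then show "is_unit c" using less.prems(3) \<open>c dvd q\<close> by (meson coprime_common_divisor)
    qed
    then obtain ks where ks: "ks \<noteq> []" "\<forall>k\<in>set ks. k \<ge> 2" "cf_num ks = q" "cf_den ks = r"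
      using less.hyps[of r q] r less.prems by auto
    have "k * q > 1 * q" using p less.prems r by linarith
    then have "k > 1" using less.prems(1) by (simp only: mult_less_cancel_right)
    then show ?thesis using ks p by (intro exI[of _ "k # ks"]) auto
  qed
qed

lemma neg_cf_expansion_eq:
  fixes p q :: int
  assumes "0 < q" "q < p" "coprime p q"
  defines "ks \<equiv> neg_cf_expansion (of_int p / of_int q)"
  shows "ks \<noteq> []" "\<forall>k\<in>set ks. k \<ge> 2" "cf_num ks = p" "cf_den ks = q"
proof -
  obtain ms where ms: "ms \<noteq> []" "\<forall>k\<in>set ms. k \<ge> 2" "cf_num ms = p" "cf_den ms = q"
    using neg_cf_exists[OF assms(1-3)] by auto
  have "ks = ms" unfolding ks_def neg_cf_expansion_def
  proof (rule the_equality)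
    show "ms \<noteq> [] \<and> (\<forall>k\<in>set ms. k \<ge> 2) \<and> neg_cont_frac ms = of_int p / of_int q"
      using ms neg_cont_frac_eq[of ms] by simp
  next
    fix ns :: "int list"
    assume "ns \<noteq> [] \<and> (\<forall>k\<in>set ns. k \<ge> 2) \<and> neg_cont_frac ns = of_int p / of_int q"
    then show "ns = ms"
      using ms neg_cont_frac_eq[of ms] by (intro neg_cont_frac_inject) auto
  qed
  then show "ks \<noteq> []" "\<forall>k\<in>set ks. k \<ge> 2" "cf_num ks = p" "cf_den ks = q" using ms by auto
qed

section \<open>Negative modular inverses and reciprocity of the two legs\<close>

lemma neg_inverse_mod_props:
  fixes s t :: int
  assumes "t > 1" "gcd s t = 1"
  shows "0 < neg_inverse_mod s t" "neg_inverse_mod s t < t" "[s * neg_inverse_mod s t = - 1] (mod t)"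
proof -
  have "coprime s t" using assms by (simp add: coprime_iff_gcd_eq_1)
  then obtain x where "[s * x = 1] (mod t)" using cong_solve_coprime_int by blast
  then have "[- (s * x) = - 1] (mod t)" by (simp only: cong_minus_minus_iff)
  then have x: "[s * (- x mod t) = - 1] (mod t)"
    by (metis cong_def mod_mult_right_eq mult_minus_right)
  define y where "y = - x mod t"
  have "y \<noteq> 0"
  proof
    assume "y = 0"
    then have "[0 = - 1] (mod t)" using x y_def by simp
    then have "t dvd 1" by (simp add: cong_iff_dvd_diff)
    then show False using assms by simp
  qed
  moreover have "0 \<le> y" "y < t" using assms unfolding y_def by simp_all
  ultimately have y: "0 < y \<and> y < t \<and> [s * y = - 1] (mod t)" using x by (simp add: y_def)
  have "z = y" if "0 < z \<and> z < t \<and> [s * z = - 1] (mod t)" for z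
  proof -
    have "[s * z = s * y] (mod t)" using that y by (metis cong_sym cong_trans)
    then have "[z = y] (mod t)"
      using \<open>coprime s t\<close> by (simp add: cong_mult_lcancel coprime_commute)
    then show ?thesis using that y by (simp add: cong_def)
  qed
  then have "neg_inverse_mod s t = y" unfolding neg_inverse_mod_def using y by (rule_tac the_equality)
  then show "0 < neg_inverse_mod s t" "neg_inverse_mod s t < t" "[s * neg_inverse_mod s t = - 1] (mod t)"
    using y by auto
qed

text \<open>The left hand side is \<open>-1\<close> modulo \<open>st\<close>, positive, and at most \<open>2st - s - t\<close>.\<close>
lemma neg_inverse_mod_reciprocity:
  fixes s t :: int
  assumes "s > 1" "t > 1" "gcd s t = 1"
  shows "s * neg_inverse_mod s t + t * neg_inverse_mod t s = s * t - 1"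
proof -
  define t' s' where "t' = neg_inverse_mod s t" and "s' = neg_inverse_mod t s"
  have t': "0 < t'" "t' < t" "[s * t' = - 1] (mod t)"
    using neg_inverse_mod_props[of t s] assms unfolding t'_def by auto
  have s': "0 < s'" "s' < s" "[t * s' = - 1] (mod s)"
    using neg_inverse_mod_props[of s t] assms unfolding s'_def by (auto simp: gcd.commute)
  have "t dvd s * t' + 1" "s dvd t * s' + 1" using t' s' by (auto simp: cong_iff_dvd_diff)
  then have "t dvd (s * t' + 1) + t * s'" "s dvd (t * s' + 1) + s * t'" by (simp_all only: dvd_add dvd_triv_left)
  then have "s dvd s * t' + t * s' + 1" "t dvd s * t' + t * s' + 1" by (simp_all add: algebra_simps)
  then have "s * t dvd s * t' + t * s' + 1"
    using assms(3) by (intro divides_mult) (auto simp: coprime_iff_gcd_eq_1)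
  then obtain k where k: "s * t' + t * s' + 1 = s * t * k" by (elim dvdE)
  have st: "s * t > 0" using assms by simp
  have "s * t' > 0" "t * s' > 0" using t' s' assms by simp_all
  then have "s * t * k > s * t * 0" using k by linarith
  then have "k > 0" using st by (simp only: mult_less_cancel_left)
  have "s * t' \<le> s * (t - 1)" "t * s' \<le> t * (s - 1)" using t' s' assms by (auto intro!: mult_left_mono)
  moreover have "s * (t - 1) + t * (s - 1) = s * t * 2 - s - t" by (simp add: algebra_simps)
  ultimately have "s * t * k < s * t * 2" using k assms by linarith
  then have "k < 2" using st by (simp only: mult_less_cancel_left)
  then have "k = 1" using \<open>k > 0\<close> by simp
  then show ?thesis using k unfolding t'_def s'_def by simp
qed

text \<open>Blowing down the \<open>-1\<close> vertex of the chain \<open>-k\<^sub>a, \<dots>, -k\<^sub>1, -1, -l\<^sub>1, \<dots>, -l\<^sub>b\<close> preserves both the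
  hypothesis and the left hand side.  This replaces the reciprocity law for Dedekind sums.\<close>
lemma blow_down_identity:
  assumes "\<forall>k\<in>set ks. k \<ge> 2" "\<forall>l\<in>set ls. l \<ge> 2"
    and "cf_num ls * cf_den ks + cf_num ks * cf_den ls = cf_num ls * cf_num ks - 1"
  shows "(\<Sum>k\<leftarrow>ks. of_int k - 3) + (\<Sum>l\<leftarrow>ls. of_int l - 3)
    + of_int (cf_conum ks + cf_num ls) / of_int (cf_num ks)
    + of_int (cf_conum ls + cf_num ks) / of_int (cf_num ls) = (2 :: rat)"
proof -
  define P where "P ks ls \<longleftrightarrow> (\<forall>k\<in>set ks. k \<ge> 2) \<and> (\<forall>l\<in>set ls. l \<ge> 2) \<and>
    cf_num ls * cf_den ks + cf_num ks * cf_den ls = cf_num ls * cf_num ks - 1" for ks ls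
  define F where "F ks ls = (\<Sum>k\<leftarrow>ks. of_int k - 3) + (\<Sum>l\<leftarrow>ls. of_int l - 3)
    + of_int (cf_conum ks + cf_num ls) / of_int (cf_num ks)
    + of_int (cf_conum ls + cf_num ks) / (of_int (cf_num ls) :: rat)" for ks ls
  have P_sym: "P ls ks" if "P ks ls" for ks ls using that by (auto simp: P_def algebra_simps)
  have F_sym: "F ls ks = F ks ls" for ks ls by (simp add: F_def algebra_simps)
  have "F ks ls = 2" if "P ks ls"
    using that
  proof (induction "length ks + length ls" arbitrary: ks ls rule: less_induct)
    case less
    \<comment> \<open>With one leg empty the hypothesis says that the denominator of the other is
      its numerator minus 1. This forces the head to be 2 and passes to the tail, so the chain
      consists of 2s only.\<close>
    have end_chain: "F [] ls = 2" if IH: "\<And>ls'. length ls' < length ls \<Longrightarrow> P [] ls' \<Longrightarrow> F [] ls' = 2"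
      and P: "P [] ls" for ls
    proof (cases ls)
      case Nil
      then show ?thesis by (simp add: F_def)
    next
      case (Cons l ms)
      define r r2 f f2 where "r = cf_num ms" and "r2 = cf_den ms" and "f = cf_conum ms" and "f2 = cf_coden ms"
      note defs = r_def r2_def f_def f2_def
      have ms: "\<forall>l\<in>set ms. l \<ge> 2" "l \<ge> 2" and eq: "r = l * r - r2 - 1"
        using P Cons by (auto simp: P_def defs)
      have r: "0 \<le> r2" "r2 < r" using cf_den_bounds[OF ms(1)] by (auto simp: defs)
      have "l = 2"
      proof (rule ccontr)
        assume "l \<noteq> 2"
        then have "3 * r \<le> l * r" using ms r by (intro mult_right_mono) auto
        then show False using r eq by linarith
      qed
      have r2: "r2 = r - 1" using eq \<open>l = 2\<close> by simp
      have "P [] ms" using ms r2 by (simp add: P_def defs)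
      then have IH: "F [] ms = 2" using IH[of ms] Cons by simp
      have "f * r2 - f2 * r = 1" using chain_wronskian[of ms] by (simp add: defs)
      then have "(2 * f - f2 + 1) * r = (f + 1) * (r + 1)" using r2 by (simp add: algebra_simps)
      then have "of_int (2 * f - f2 + 1) * of_int r = (of_int (f + 1) * of_int (r + 1) :: rat)"
        by (metis of_int_mult)
      then have "of_int (2 * f - f2 + 1) / of_int (r + 1) = (of_int (f + 1) / of_int r :: rat)"
        using r by (subst frac_eq_eq) auto
      moreover have "F [] ls = -1 + (\<Sum>l\<leftarrow>ms. of_int l - 3) + of_int (r + 1) +
          of_int (2 * f - f2 + 1) / of_int (r + 1)"
        using r2 \<open>l = 2\<close> Cons by (simp add: F_def r_def r2_def f_def f2_def)
      moreover have "F [] ms = (\<Sum>l\<leftarrow>ms. of_int l - 3) + of_int r + of_int (f + 1) / of_int r"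
        by (simp add: F_def defs)
      ultimately show ?thesis using IH by simp
    qed
    \<comment> \<open>Blowing down turns the neighbour of weight -2 into the new -1 vertex and
      raises the weight -l to -(l - 1), whence the new legs \<open>ks\<close> and
      \<open>(l - 1) # ls\<close>. In the sums, the -1 of the removed entry 2 matches the drop from
      l - 3 to l - 4.\<close>
    have blow_down: "F (k # ks) (l # ls) = 2"
      if IH: "P ks ((l - 1) # ls) \<Longrightarrow> F ks ((l - 1) # ls) = 2" and "k = 2" "l > 2" 
        and P: "P (k # ks) (l # ls)" for k l ks ls
    proof -
      define r r2 f f2 where "r = cf_num ls" and "r2 = cf_den ls" and "f = cf_conum ls" and "f2 = cf_coden ls"
      define p p2 e e2 where "p = cf_num ks" and "p2 = cf_den ks" and "e = cf_conum ks" and "e2 = cf_coden ks"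
      note defs = r_def r2_def f_def f2_def p_def p2_def e_def e2_def
      define s t E G where "s = l * r - r2" and "t = 2 * p - p2" and "E = 2 * e - e2" and "G = l * f - f2"
      have bnd: "0 \<le> p2" "p2 < p" "0 \<le> r2" "r2 < r"
        using P cf_den_bounds[of ks] cf_den_bounds[of ls] by (auto simp: P_def defs)
      have eq: "s * p + t * r = s * t - 1"
        using P \<open>k = 2\<close> by (simp add: P_def defs s_def t_def)
      have sr: "s - r = (l - 1) * r - r2" by (simp add: s_def algebra_simps)
      have "2 * r \<le> (l - 1) * r" using \<open>l > 2\<close> bnd by (intro mult_right_mono) auto
      then have sr_pos: "s - r > 0" "s > 0" using sr bnd by linarith+
      have t_pos: "t > 0" using bnd t_def by linarith
      have w1: "E * p - e * t = 1" and w2: "G * r - f * s = 1"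
        using chain_wronskian[of ks] chain_wronskian[of ls]
        by (simp_all add: defs E_def G_def s_def t_def algebra_simps)
      have "(s - r) * p2 + p * r = (s - r) * p - 1"
        using eq by (simp add: t_def algebra_simps)
      then have "P ks ((l - 1) # ls)"
        using P \<open>l > 2\<close> unfolding sr by (simp add: P_def r_def r2_def p_def p2_def)
      then have IH: "F ks ((l - 1) # ls) = 2" by (rule IH)
      \<comment> \<open>The 1 of the Wronskian and the -1 of the hypothesis cancel here, so the
        fraction keeps its value under the blow down. The second fraction is treated in the same
        way.\<close>
      have "(E + s) * p = (e + (s - r)) * t" using w1 eq by (simp add: algebra_simps)
      then have "of_int (E + s) * of_int p = (of_int (e + (s - r)) * of_int t :: rat)"
        by (metis of_int_mult)
      then have 1: "of_int (E + s) / of_int t = (of_int (e + (s - r)) / of_int p :: rat)"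
        using bnd t_pos by (subst frac_eq_eq) auto
      have "(G + t) * (s - r) = (G - f + p) * s" using w2 eq by (simp add: algebra_simps)
      then have "of_int (G + t) * of_int (s - r) = (of_int (G - f + p) * of_int s :: rat)"
        by (metis of_int_mult)
      then have 2: "of_int (G + t) / of_int s = (of_int (G - f + p) / of_int (s - r) :: rat)"
        using sr_pos by (subst frac_eq_eq) auto
      have "F (k # ks) (l # ls) = -1 + (\<Sum>k\<leftarrow>ks. of_int k - 3) + (of_int l - 3) + (\<Sum>l\<leftarrow>ls. of_int l - 3)
          + of_int (E + s) / of_int t + of_int (G + t) / of_int s"
        unfolding F_def using \<open>k = 2\<close> by (simp add: r_def r2_def p_def p2_def f_def f2_def e_def e2_def E_def G_def s_def t_def)
      moreover have "F ks ((l - 1) # ls) = (\<Sum>k\<leftarrow>ks. of_int k - 3) + (of_int l - 4) + (\<Sum>l\<leftarrow>ls. of_int l - 3)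
          + of_int (e + (s - r)) / of_int p + of_int (G - f + p) / of_int (s - r)"
      proof -
        have *: "cf_num ((l - 1) # ls) = s - r" "cf_conum ((l - 1) # ls) = G - f"
          by (simp_all add: s_def r_def r2_def G_def f_def f2_def algebra_simps)
        show ?thesis unfolding F_def * by (simp add: p_def e_def)
      qed
      ultimately show ?thesis using IH unfolding 1 2 by simp
    qed
    show ?case
    proof (cases "ks = [] \<or> ls = []")
      case True
      then show ?thesis
      proof
        assume "ks = []"
        then show ?thesis using end_chain[of ls] less by simp
      next
        assume "ls = []"
        have "F [] ks = 2"
        proof (rule end_chain)
          fix ls' :: "int list" assume "length ls' < length ks" "P [] ls'"
          then show "F [] ls' = 2" using less.hyps[of "[]" ls'] \<open>ls = []\<close> by simp
        next
          show "P [] ks" using P_sym less.prems \<open>ls = []\<close> by blast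
        qed
        then show ?thesis using F_sym \<open>ls = []\<close> by simp
      qed
    next
      case False
      then obtain k ks' l ls' where cons: "ks = k # ks'" "ls = l # ls'"
        by (metis neq_Nil_conv)
      define p p2 r r2 where "p = cf_num ks'" and "p2 = cf_den ks'" and "r = cf_num ls'" and "r2 = cf_den ls'"
      note defs = p_def p2_def r_def r2_def
      have kl: "k \<ge> 2" "l \<ge> 2" using less.prems cons by (auto simp: P_def)
      have bnd: "0 \<le> p2" "p2 < p" "0 \<le> r2" "r2 < r"
        using less.prems cf_den_bounds[of ks'] cf_den_bounds[of ls'] by (auto simp: P_def defs cons)
      define s t where "s = l * r - r2" and "t = k * p - p2"
      \<comment> \<open>Divided by s t this reads p / t + r / s = 1 - 1 / (s t). Two heads equal to
        2 would make both ratios at least 1/2; two heads above 2 would make both too small. So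
        exactly one head is 2, and a blow down applies.\<close>
      have eq: "s * p + t * r = s * t - 1"
        using less.prems by (simp add: P_def defs s_def t_def cons)
      have "2 * p \<le> k * p" "2 * r \<le> l * r" using kl bnd by (auto intro!: mult_right_mono)
      then have pos: "t > p" "s > r" using bnd unfolding s_def t_def by linarith+
      have "\<not> (k = 2 \<and> l = 2)"
      proof
        assume "k = 2 \<and> l = 2"
        then have "t \<le> 2 * p" "s \<le> 2 * r" using bnd by (auto simp: s_def t_def)
        then have "s * t \<le> s * (2 * p)" "t * s \<le> t * (2 * r)" using pos bnd by (auto intro!: mult_left_mono)
        then show False using eq by (simp add: algebra_simps)
      qed
      moreover have "\<not> (k > 2 \<and> l > 2)"
      proof
        assume "k > 2 \<and> l > 2"
        then have "3 * p \<le> k * p" "3 * r \<le> l * r" using bnd by (auto intro!: mult_right_mono)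
        then have "2 * p \<le> t - 1" "2 * r \<le> s - 1" using bnd unfolding s_def t_def by linarith+
        then have "s * (2 * p) \<le> s * (t - 1)" "t * (2 * r) \<le> t * (s - 1)"
          using pos bnd by (auto intro!: mult_left_mono)
        then have "s + t \<le> 2" using eq by (simp add: algebra_simps)
        then show False using pos bnd by linarith
      qed
      ultimately consider "k = 2" "l > 2" | "l = 2" "k > 2" using kl by linarith
      then show ?thesis
      proof cases
        case 1
        then show ?thesis
          using blow_down[of ks' l ls' k] less.hyps[of ks' "(l - 1) # ls'"] less.prems cons by simp
      next
        case 2
        then have "F ls ks = 2"
          using blow_down[of ls' k ks' l] less.hyps[of ls' "(k - 1) # ks'"] P_sym[OF less.prems] cons by simp
        then show ?thesis using F_sym by simp
      qed
    qed
  qed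
  then show ?thesis using assms by (simp add: P_def F_def)
qed

section \<open>Principal values\<close>

lemma pv_const_coeff_nth:
  "pv_const_coeff p l =
     (fls_nth ((fls_X - fls_X_inv) powi p) (- l) + fls_nth ((fls_X_inv - fls_X) powi p) l) / 2"
  unfolding pv_const_coeff_def fls_X_intpow_times_conv_shift by simp

lemma pv_const_coeff_0: "pv_const_coeff 0 l = (if l = 0 then 1 else 0)"
  unfolding pv_const_coeff_nth power_int_0_right fls_one_nth neg_equal_0_iff_equal by simp

lemma pv_const_coeff_1: "pv_const_coeff 1 l = (if l = - 1 then 1 else if l = 1 then - 1 else 0)"
proof -
  have "- l = 1 \<longleftrightarrow> l = - 1" "- l = - 1 \<longleftrightarrow> l = 1" by linarith+
  then have "pv_const_coeff 1 l = ((if l = - 1 then 1 else 0) - (if l = 1 then 1 else 0)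
      + ((if l = - 1 then 1 else 0) - (if l = 1 then 1 else 0))) / 2"
    unfolding pv_const_coeff_nth power_int_1_right fls_minus_nth fls_X_nth fls_X_inv_nth by (simp only:)
  then show ?thesis by (simp only: if_True if_False split: if_split) simp
qed

text \<open>Geometric series: 1 / (z - 1/z) = - z / (1 - z^2) = - (z + z^3 + z^5 + ...).\<close>

lemma inverse_fls_X_diff_nth:
  "fls_nth (inverse (fls_X - fls_X_inv :: rat fls)) k = (if odd k \<and> k > 0 then - 1 else 0)"
proof -
  define G :: "rat fls" where "G = fps_to_fls (Abs_fps (\<lambda>n. if odd n then - 1 else 0))"
  have G: "fls_nth G k = (if odd k \<and> k > 0 then - 1 else 0)" for k
    by (cases "k > 0") (simp_all add: G_def even_nat_iff)
  have "(fls_X - fls_X_inv) * G = 1"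
    by (rule fls_eqI) (auto simp: left_diff_distrib fls_X_times_conv_shift fls_X_inv_times_conv_shift G)
  then have "inverse (fls_X - fls_X_inv) = G" by (rule inverse_unique)
  then show ?thesis by (simp only: G)
qed

text \<open>The two expansions are one odd series in z and one in 1/z, with opposite signs. An odd
  \<open>l\<close> meets exactly one of them, and averaging leaves half its sign.\<close>

lemma pv_const_coeff_m1: "pv_const_coeff (- 1) l = (if odd l then of_int (sgn l) / 2 else 0)"
proof -
  let ?I = "fls_nth (inverse (fls_X - fls_X_inv :: rat fls))"
  have "fls_X_inv - fls_X = - (fls_X - fls_X_inv :: rat fls)" by (simp only: minus_diff_eq)
  then have "inverse (fls_X_inv - fls_X) = - inverse (fls_X - fls_X_inv :: rat fls)"
    by (simp only: inverse_minus_eq)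
  then have "pv_const_coeff (- 1) l = (?I (- l) - ?I l) / 2"
    unfolding pv_const_coeff_nth power_int_minus power_int_1_right by (simp only: fls_uminus_nth diff_conv_add_uminus)
  then have eq: "pv_const_coeff (- 1) l =
      ((if odd l \<and> l < 0 then - 1 else 0) - (if odd l \<and> l > 0 then - 1 else 0)) / 2"
    unfolding inverse_fls_X_diff_nth by (simp only: even_minus neg_0_less_iff_less)
  show ?thesis unfolding eq by (cases l "0 :: int" rule: linorder_cases) simp_all
qed

section \<open>Semidefinite and unimodular matrices\<close>

definition symmetric_mat :: "'a mat \<Rightarrow> bool" where
  "symmetric_mat A \<longleftrightarrow> (\<forall>i<dim_row A. \<forall>j<dim_row A. A $$ (i, j) = A $$ (j, i))"

definition neg_semidefinite :: "real mat \<Rightarrow> bool" where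
  "neg_semidefinite A \<longleftrightarrow> (\<forall>x\<in>carrier_vec (dim_row A). x \<bullet> (A *\<^sub>v x) \<le> 0)"

text \<open>Turns real-rootedness into a count with multiplicity: the fundamental theorem of algebra
  supplies a complex root, the hypothesis makes it real, and the linear factor splits off over the
  reals.\<close>

lemma size_proots_real_rooted:
  fixes p :: "real poly"
  assumes "p \<noteq> 0" and "\<And>z. poly (map_poly complex_of_real p) z = 0 \<Longrightarrow> z \<in> \<real>"
  shows "size (proots p) = degree p"
  using assms
proof (induction "degree p" arbitrary: p rule: less_induct)
  interpret map_poly_of_real: map_poly_comm_ring_hom complex_of_real ..
  case less
  show ?case
  proof (cases "degree p = 0")
    case True
    then show ?thesis by (metis proots_const degree_eq_zeroE size_empty zero_multiset_def)
  next
    case False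
    then have "degree (map_poly complex_of_real p) \<noteq> 0" by simp
    then have "\<not> constant (poly (map_poly complex_of_real p))"
      using constant_degree by metis
    then obtain z where z: "poly (map_poly complex_of_real p) z = 0"
      using fundamental_theorem_of_algebra by blast
    then obtain x where x: "z = complex_of_real x" using less.prems(2) by (auto elim: Reals_cases)
    then have "complex_of_real (poly p x) = 0" using z by (metis of_real_hom.poly_map_poly)
    then have "[:- x, 1:] dvd p" by (simp add: poly_eq_0_iff_dvd)
    then obtain q where q: "p = [:- x, 1:] * q" by (elim dvdE)
    have q0: "q \<noteq> 0" using q less.prems(1) by auto
    have deg: "degree p = Suc (degree q)" unfolding q using q0 by (subst degree_mult_eq) auto
    have "size (proots q) = degree q"
    proof (rule less.hyps)
      fix w assume "poly (map_poly complex_of_real q) w = 0"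
      then have "poly (map_poly complex_of_real p) w = 0"
        unfolding q map_poly_of_real.hom_mult poly_mult by simp
      then show "w \<in> \<real>" by (rule less.prems(2))
    qed (use deg q0 in auto)
    then show ?thesis unfolding deg unfolding q using q0 by (subst proots_mult) auto
  qed
qed

lemma quadratic_form_sum:
  fixes A :: "'a :: comm_ring_1 mat"
  assumes "A \<in> carrier_mat n n" "x \<in> carrier_vec n" "y \<in> carrier_vec n"
  shows "x \<bullet> (A *\<^sub>v y) = (\<Sum>i<n. \<Sum>j<n. A $$ (i, j) * x $ i * y $ j)"
  using assms by (simp add: scalar_prod_def sum_distrib_left lessThan_atLeast0 algebra_simps)

text \<open>If \<open>A (x + i y) = (\<alpha> + i \<beta>) (x + i y)\<close> with \<open>x, y\<close> real, comparing \<open>y \<bullet> A x\<close> with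
  \<open>x \<bullet> A y\<close> gives \<open>\<beta> (x \<bullet> x + y \<bullet> y) = 0\<close>.\<close>
lemma symmetric_char_poly_real_rooted:
  assumes A: "A \<in> carrier_mat n n" and sym: "symmetric_mat A"
    and root: "poly (map_poly complex_of_real (char_poly A)) z = 0"
  shows "z \<in> \<real>"
proof -
  let ?C = "map_mat complex_of_real A"
  have C: "?C \<in> carrier_mat n n" using A by simp
  have "poly (char_poly ?C) z = 0" using root by (simp add: of_real_hom.char_poly_hom[OF A])
  then have "eigenvalue ?C z" using eigenvalue_root_char_poly[OF C] by simp
  then obtain v where v: "v \<in> carrier_vec n" "v \<noteq> 0\<^sub>v n" "?C *\<^sub>v v = z \<cdot>\<^sub>v v"
    using A unfolding eigenvalue_def eigenvector_def by auto
  define x y where "x = map_vec Re v" and "y = map_vec Im v"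
  have comp: "(\<Sum>j<n. complex_of_real (A $$ (i, j)) * v $ j) = z * v $ i" if "i < n" for i
    using arg_cong[OF v(3), of "\<lambda>u. u $ i"] that A v(1)
    by (simp add: scalar_prod_def lessThan_atLeast0)
  have Ax: "(\<Sum>j<n. A $$ (i, j) * x $ j) = Re z * x $ i - Im z * y $ i"
    and Ay: "(\<Sum>j<n. A $$ (i, j) * y $ j) = Im z * x $ i + Re z * y $ i" if "i < n" for i
    using arg_cong[OF comp[OF that], of Re] arg_cong[OF comp[OF that], of Im] that v(1)
    by (simp_all add: x_def y_def)
  have "(\<Sum>i<n. \<Sum>j<n. A $$ (i, j) * y $ i * x $ j) = (\<Sum>j<n. \<Sum>i<n. A $$ (i, j) * y $ i * x $ j)"
    by (rule sum.swap)
  also have "\<dots> = (\<Sum>i<n. \<Sum>j<n. A $$ (i, j) * x $ i * y $ j)"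
    using sym A by (intro sum.cong refl) (auto simp: symmetric_mat_def)
  finally have "(\<Sum>i<n. y $ i * (\<Sum>j<n. A $$ (i, j) * x $ j)) = (\<Sum>i<n. x $ i * (\<Sum>j<n. A $$ (i, j) * y $ j))"
    by (simp add: sum_distrib_left algebra_simps)
  then have "(\<Sum>i<n. y $ i * (Re z * x $ i - Im z * y $ i)) = (\<Sum>i<n. x $ i * (Im z * x $ i + Re z * y $ i))"
    by (simp add: Ax Ay)
  then have "(\<Sum>i<n. x $ i * (Im z * x $ i + Re z * y $ i) - y $ i * (Re z * x $ i - Im z * y $ i)) = 0"
    by (simp add: sum_subtractf)
  then have "Im z * (\<Sum>i<n. (x $ i)\<^sup>2 + (y $ i)\<^sup>2) = 0"
    by (simp add: sum_distrib_left algebra_simps power2_eq_square)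
  moreover have "(\<Sum>i<n. (x $ i)\<^sup>2 + (y $ i)\<^sup>2) \<noteq> 0"
  proof
    assume "(\<Sum>i<n. (x $ i)\<^sup>2 + (y $ i)\<^sup>2) = 0"
    then have "\<forall>i<n. (x $ i)\<^sup>2 + (y $ i)\<^sup>2 = 0" by (subst (asm) sum_nonneg_eq_0_iff) auto
    then have "v = 0\<^sub>v n" using v(1) by (intro eq_vecI) (auto simp: x_def y_def complex_eq_iff)
    then show False using v(2) by simp
  qed
  ultimately show ?thesis by (simp add: complex_is_Real_iff)
qed

lemma neg_semidefinite_eigenvalue:
  assumes A: "A \<in> carrier_mat n n" and nsd: "neg_semidefinite A" and ev: "eigenvalue A k"
  shows "k \<le> 0"
proof -
  obtain v where v: "v \<in> carrier_vec n" "v \<noteq> 0\<^sub>v n" "A *\<^sub>v v = k \<cdot>\<^sub>v v"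
    using A ev unfolding eigenvalue_def eigenvector_def by auto
  have "v \<bullet> v > 0"
  proof -
    obtain i where i: "i < n" "v $ i \<noteq> 0" using v by (metis carrier_vecD eq_vecI index_zero_vec)
    then show ?thesis unfolding scalar_prod_def using v
      by (intro sum_pos2[of _ i]) (auto simp: not_sum_power2_lt_zero)
  qed
  moreover have "k * (v \<bullet> v) \<le> 0" using nsd A v unfolding neg_semidefinite_def by auto
  ultimately show ?thesis by (simp add: mult_le_0_iff)
qed

text \<open>The characteristic polynomial is monic, hence positive far to the right. A negative
  value at 0 would produce a positive root, which is an eigenvalue of the wrong sign.\<close>

lemma neg_semidefinite_char_poly_0:
  assumes A: "A \<in> carrier_mat n n" and nsd: "neg_semidefinite A"
  shows "poly (char_poly A) 0 \<ge> 0"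
proof (rule ccontr)
  assume neg: "\<not> poly (char_poly A) 0 \<ge> 0"
  have monic: "lead_coeff (char_poly A) = 1" using degree_monic_char_poly[OF A] by auto
  then obtain c where c: "\<forall>x\<ge>c. poly (char_poly A) x \<ge> lead_coeff (char_poly A)"
    using poly_pinfty_gt_lc[of "char_poly A"] by auto
  define d where "d = max c 1"
  have "poly (char_poly A) d > 0" using c monic unfolding d_def by (smt (verit) max.cobounded1)
  moreover have "0 < d" by (simp add: d_def)
  ultimately obtain x where "x > 0" "poly (char_poly A) x = 0"
    using poly_IVT_pos[of 0 d "char_poly A"] neg by auto
  then show False
    using neg_semidefinite_eigenvalue[OF A nsd, of x] eigenvalue_root_char_poly[OF A, of x] by simp
qed

section \<open>Deleting a row and the corresponding column\<close>

lemma sum_insert_index: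
  fixes g :: "nat \<Rightarrow> 'a :: comm_monoid_add"
  assumes "i < Suc n" "g i = 0"
  shows "(\<Sum>j<Suc n. g j) = (\<Sum>j<n. g (insert_index i j))"
proof -
  have "(\<Sum>j<Suc n. g j) = (\<Sum>j\<in>{..<Suc n} - {i}. g j)"
    using assms by (simp add: sum.remove[of _ i] del: sum.lessThan_Suc)
  also have "\<dots> = (\<Sum>j<n. g (insert_index i j))"
    using assms by (intro sum.reindex_bij_witness[of _ "insert_index i" "delete_index i"])
      (auto simp: insert_index_def delete_index_def)
  finally show ?thesis .
qed

definition drop_coord :: "nat \<Rightarrow> 'a vec \<Rightarrow> 'a vec" where
  "drop_coord i y = vec (dim_vec y - 1) (\<lambda>j. y $ insert_index i j)"

lemma drop_coord_carrier [simp]: "y \<in> carrier_vec (Suc n) \<Longrightarrow> drop_coord i y \<in> carrier_vec n"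
  by (simp add: drop_coord_def carrier_vecD)

lemma insert_index_less: "i < Suc n \<Longrightarrow> j < n \<Longrightarrow> insert_index i j < Suc n"
  by (simp add: insert_index_def)

lemma drop_coord_surj:
  fixes x :: "'a :: zero vec"
  assumes "x \<in> carrier_vec n" "i < Suc n"
  obtains y where "y \<in> carrier_vec (Suc n)" "y $ i = 0" "x = drop_coord i y"
proof
  let ?y = "vec (Suc n) (\<lambda>j. if j = i then 0 else x $ delete_index i j)"
  show "?y \<in> carrier_vec (Suc n)" "?y $ i = 0" using assms by auto
  show "x = drop_coord i ?y"
    using assms by (intro eq_vecI) (auto simp: drop_coord_def insert_index_def delete_index_def)
qed

text \<open>The deleted column only meets the entry \<open>y $ i = 0\<close>. Hence questions about
  the reduced matrix can be asked of the full matrix on vectors vanishing at \<open>i\<close>,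
  without renumbering the vertices.\<close>

lemma mat_delete_mult_drop_coord:
  fixes A :: "'a :: comm_ring_1 mat"
  assumes A: "A \<in> carrier_mat (Suc n) (Suc n)" and i: "i < Suc n"
    and y: "y \<in> carrier_vec (Suc n)" "y $ i = 0"
  shows "mat_delete A i i *\<^sub>v drop_coord i y = drop_coord i (A *\<^sub>v y)"
proof (rule eq_vecI)
  fix j assume "j < dim_vec (drop_coord i (A *\<^sub>v y))"
  then have j: "j < n" using A by (simp add: drop_coord_def)
  have D: "mat_delete A i i \<in> carrier_mat n n" using mat_delete_carrier[OF A] by simp
  have "drop_coord i (A *\<^sub>v y) $ j = (\<Sum>k<Suc n. A $$ (insert_index i j, k) * y $ k)"
    using A y insert_index_less[OF i j] j
    by (simp add: drop_coord_def scalar_prod_def lessThan_atLeast0 del: sum.op_ivl_Suc)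
  also have "\<dots> = (\<Sum>k<n. A $$ (insert_index i j, insert_index i k) * y $ insert_index i k)"
    using i y by (intro sum_insert_index) auto
  also have "\<dots> = (\<Sum>k<n. mat_delete A i i $$ (j, k) * y $ insert_index i k)"
    using j by (intro sum.cong refl) (simp add: mat_delete_index[OF A i i])
  also have "\<dots> = (mat_delete A i i *\<^sub>v drop_coord i y) $ j"
    using A D y j carrier_matD[OF D] by (simp add: drop_coord_def scalar_prod_def lessThan_atLeast0)
  finally show "(mat_delete A i i *\<^sub>v drop_coord i y) $ j = drop_coord i (A *\<^sub>v y) $ j" by simp
qed (use A in \<open>simp add: drop_coord_def mat_delete_def\<close>)

lemma quadratic_form_mat_delete:
  fixes A :: "'a :: comm_ring_1 mat"
  assumes A: "A \<in> carrier_mat (Suc n) (Suc n)" and i: "i < Suc n"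
    and y: "y \<in> carrier_vec (Suc n)" "y $ i = 0"
  shows "drop_coord i y \<bullet> (mat_delete A i i *\<^sub>v drop_coord i y) = y \<bullet> (A *\<^sub>v y)"
proof -
  have "y \<bullet> (A *\<^sub>v y) = (\<Sum>j<Suc n. y $ j * (A *\<^sub>v y) $ j)"
    using A by (simp add: scalar_prod_def lessThan_atLeast0 del: sum.op_ivl_Suc index_mult_mat_vec)
  also have "\<dots> = (\<Sum>j<n. y $ insert_index i j * (A *\<^sub>v y) $ insert_index i j)"
    using i y by (intro sum_insert_index) auto
  also have "\<dots> = drop_coord i y \<bullet> drop_coord i (A *\<^sub>v y)"
    using A y by (simp add: scalar_prod_def drop_coord_def lessThan_atLeast0 del: index_mult_mat_vec)
  finally show ?thesis by (simp add: mat_delete_mult_drop_coord[OF assms])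
qed

lemma neg_semidefinite_mat_delete:
  assumes A: "A \<in> carrier_mat (Suc n) (Suc n)" and nsd: "neg_semidefinite A" and i: "i < Suc n"
  shows "neg_semidefinite (mat_delete A i i)"
  unfolding neg_semidefinite_def
proof
  fix x :: "real vec" assume "x \<in> carrier_vec (dim_row (mat_delete A i i))"
  then have "x \<in> carrier_vec n" using A by (simp add: mat_delete_def)
  then obtain y where "y \<in> carrier_vec (Suc n)" "y $ i = 0" "x = drop_coord i y"
    using i by (rule drop_coord_surj)
  then show "x \<bullet> (mat_delete A i i *\<^sub>v x) \<le> 0"
    using nsd A i by (auto simp: neg_semidefinite_def quadratic_form_mat_delete[of A n])
qed

text \<open>Integer preimages of the unit vectors are the columns of an integer right inverse, so
  the determinant divides 1.\<close>

lemma abs_det_eq_1_if_surj: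
  fixes A :: "int mat"
  assumes A: "A \<in> carrier_mat n n"
    and surj: "\<And>w. w \<in> carrier_vec n \<Longrightarrow> \<exists>x\<in>carrier_vec n. A *\<^sub>v x = w"
  shows "\<bar>det A\<bar> = 1"
proof -
  obtain f where f: "f k \<in> carrier_vec n" "A *\<^sub>v f k = unit_vec n k" for k
    using surj[of "unit_vec n _"] by (metis unit_vec_carrier)
  define B where "B = mat n n (\<lambda>(i, k). f k $ i)"
  have B: "B \<in> carrier_mat n n" by (simp add: B_def)
  have col: "col B k = f k" if "k < n" for k
    using that f(1)[of k] by (intro eq_vecI) (auto simp: B_def)
  have "A * B = 1\<^sub>m n"
  proof (rule eq_matI)
    fix i k assume *: "i < dim_row (1\<^sub>m n :: int mat)" "k < dim_col (1\<^sub>m n :: int mat)"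
    then have "(A * B) $$ (i, k) = (A *\<^sub>v f k) $ i" using A B col by simp
    also have "\<dots> = unit_vec n k $ i" by (simp only: f(2))
    finally show "(A * B) $$ (i, k) = 1\<^sub>m n $$ (i, k)" using * by simp
  qed (use A B in auto)
  then have "det A * det B = 1" using det_mult[OF A B] by simp
  then have "\<bar>det A * det B\<bar> = 1" by simp
  then show ?thesis by (rule abs_zmult_eq_1)
qed

text \<open>All n + 1 roots of the characteristic polynomial are real and none is positive. The
  count thus reduces to showing that 0 is a simple root, which is where the nonzero principal minor
  enters.\<close>

lemma eigenvalue_counts_neg_semidefinite:
  assumes A: "A \<in> carrier_mat (Suc n) (Suc n)" and sym: "symmetric_mat A" and nsd: "neg_semidefinite A"
    and det: "det A = 0" and i: "i < Suc n" and minor: "det (mat_delete A i i) \<noteq> 0"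
  shows "num_pos_eigenvalues A = 0" "num_neg_eigenvalues A = n"
proof -
  let ?p = "char_poly A"
  have p: "degree ?p = Suc n" "?p \<noteq> 0" using degree_monic_char_poly[OF A] by auto
  have ev: "eigenvalue A x \<longleftrightarrow> poly ?p x = 0" for x by (rule eigenvalue_root_char_poly[OF A])
  have le: "x \<le> 0" if "poly ?p x = 0" for x
    using neg_semidefinite_eigenvalue[OF A nsd, of x] that ev by simp
  then have "{x. eigenvalue A x \<and> x > 0} = {}" using ev by force
  then show "num_pos_eigenvalues A = 0" unfolding num_pos_eigenvalues_def by (metis sum.empty)
  have at_0: "poly (char_poly B) 0 = 0 \<longleftrightarrow> det B = 0" if "B \<in> carrier_mat m m" for B :: "real mat" and m
  proof -
    have "char_matrix B 0 = B" using that by (auto simp: char_matrix_def intro!: eq_matI)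
    then show ?thesis
      using eigenvalue_det[OF that, of 0] eigenvalue_root_char_poly[OF that, of 0] by simp
  qed
  have root0: "poly ?p 0 = 0" using at_0[OF A] det by simp
  have D: "mat_delete A j j \<in> carrier_mat n n" for j using mat_delete_carrier[OF A] by simp
  have ge: "poly (char_poly (mat_delete A j j)) 0 \<ge> 0" if "j < Suc n" for j
    by (rule neg_semidefinite_char_poly_0[OF D neg_semidefinite_mat_delete[OF A nsd that]])
  have "poly (char_poly (mat_delete A i i)) 0 \<noteq> 0" using at_0[OF D] minor by simp
  \<comment> \<open>The derivative is the sum of the characteristic polynomials of the principal
    submatrices of size n. All are nonnegative at 0, so no cancellation can occur, and the one for
    \<open>i\<close> is nonzero.\<close>
  then have "poly (pderiv ?p) 0 > 0"
    unfolding pderiv_char_poly[OF A] poly_sum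
    using ge i by (intro sum_pos2[of _ i]) (auto simp: order_less_le)
  then have ord: "order 0 ?p = 1"
    using order_pderiv[of ?p 0] root0 p by (simp add: order_0I[of "pderiv ?p" 0] pderiv_eq_0_iff)
  have "(\<Sum>x\<in>{x. poly ?p x = 0}. order x ?p) = size (proots ?p)"
    using p by (simp add: size_multiset_overloaded_eq)
  also have "\<dots> = Suc n"
    unfolding p(1)[symmetric] using symmetric_char_poly_real_rooted[OF A sym]
    by (intro size_proots_real_rooted[OF p(2)])
  finally have "(\<Sum>x\<in>{x. poly ?p x = 0}. order x ?p) = Suc n" .
  moreover have "{x. poly ?p x = 0} = insert 0 {x. eigenvalue A x \<and> x < 0}"
    using le root0 ev by (auto simp: order_le_less)
  moreover have "finite {x. eigenvalue A x \<and> x < 0}" using poly_roots_finite[OF p(2)] ev by simp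
  ultimately show "num_neg_eigenvalues A = n" using ord unfolding num_neg_eigenvalues_def by simp
qed

text \<open>Substitute \<open>x\<^sub>i = u\<^sub>i \<xi>\<^sub>i\<close>; the kernel equation kills the terms with \<open>\<xi>\<^sub>i\<^sup>2\<close> and \<open>\<xi>\<^sub>j\<^sup>2\<close>.\<close>
lemma quadratic_form_positive_kernel:
  fixes A :: "real mat"
  assumes A: "A \<in> carrier_mat n n" and sym: "symmetric_mat A"
    and u: "\<And>i. i < n \<Longrightarrow> u i > 0" and ker: "\<And>i. i < n \<Longrightarrow> (\<Sum>j<n. A $$ (i, j) * u j) = 0"
    and x: "x \<in> carrier_vec n"
  shows "x \<bullet> (A *\<^sub>v x) = - (\<Sum>i<n. \<Sum>j<n. A $$ (i, j) * u i * u j * (x $ i / u i - x $ j / u j)\<^sup>2) / 2"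
proof -
  define \<xi> where "\<xi> i = x $ i / u i" for i
  have x\<xi>: "x $ i = u i * \<xi> i" if "i < n" for i using u[OF that] by (simp add: \<xi>_def)
  have row: "(\<Sum>i<n. \<Sum>j<n. A $$ (i, j) * u i * u j * (\<xi> i)\<^sup>2) = 0"
  proof -
    have "(\<Sum>i<n. \<Sum>j<n. A $$ (i, j) * u i * u j * (\<xi> i)\<^sup>2)
        = (\<Sum>i<n. u i * (\<xi> i)\<^sup>2 * (\<Sum>j<n. A $$ (i, j) * u j))"
      by (simp add: sum_distrib_left algebra_simps)
    then show ?thesis using ker by simp
  qed
  have "(\<Sum>i<n. \<Sum>j<n. A $$ (i, j) * u i * u j * (\<xi> j)\<^sup>2) = (\<Sum>j<n. \<Sum>i<n. A $$ (i, j) * u i * u j * (\<xi> j)\<^sup>2)"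
    by (rule sum.swap)
  also have "\<dots> = (\<Sum>i<n. \<Sum>j<n. A $$ (i, j) * u i * u j * (\<xi> i)\<^sup>2)"
    using sym A by (intro sum.cong refl) (auto simp: symmetric_mat_def)
  finally have col: "(\<Sum>i<n. \<Sum>j<n. A $$ (i, j) * u i * u j * (\<xi> j)\<^sup>2) = 0" using row by simp
  have "(\<Sum>i<n. \<Sum>j<n. A $$ (i, j) * u i * u j * (\<xi> i - \<xi> j)\<^sup>2)
      = (\<Sum>i<n. \<Sum>j<n. A $$ (i, j) * u i * u j * (\<xi> i)\<^sup>2) + (\<Sum>i<n. \<Sum>j<n. A $$ (i, j) * u i * u j * (\<xi> j)\<^sup>2)
        - 2 * (\<Sum>i<n. \<Sum>j<n. A $$ (i, j) * (u i * \<xi> i) * (u j * \<xi> j))"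
    unfolding sum_distrib_left sum.distrib[symmetric] sum_subtractf[symmetric]
    by (intro sum.cong refl) (simp add: power2_diff algebra_simps)
  also have "\<dots> = - 2 * (\<Sum>i<n. \<Sum>j<n. A $$ (i, j) * (u i * \<xi> i) * (u j * \<xi> j))"
    using row col by simp
  also have "(\<Sum>i<n. \<Sum>j<n. A $$ (i, j) * (u i * \<xi> i) * (u j * \<xi> j)) = x \<bullet> (A *\<^sub>v x)"
    unfolding quadratic_form_sum[OF A x x] by (intro sum.cong refl) (simp add: x\<xi>)
  finally show ?thesis by (simp add: \<xi>_def)
qed

section \<open>Plumbing trees with a positive kernel vector\<close>

abbreviation nbrs :: "plumbing_graph \<Rightarrow> nat \<Rightarrow> nat set" where
  "nbrs H v \<equiv> {u. {u, v} \<in> edges H}"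

lemma edge_in_verts:
  assumes "is_tree H" "{u, v} \<in> edges H"
  shows "u < num_verts H" "v < num_verts H" "u \<noteq> v"
  using assms by (auto simp: is_tree_def verts_def dest!: bspec)

lemma degree_at_eq_card_nbrs:
  assumes "is_tree H"
  shows "degree_at H v = card (nbrs H v)"
proof -
  have "inj_on (\<lambda>u. {u, v}) (nbrs H v)" by (auto simp: inj_on_def doubleton_eq_iff)
  then have "card ((\<lambda>u. {u, v}) ` nbrs H v) = card (nbrs H v)" by (rule card_image)
  moreover have "(\<lambda>u. {u, v}) ` nbrs H v = {e \<in> edges H. v \<in> e}"
  proof safe
    fix e assume e: "e \<in> edges H" "v \<in> e"
    then have "card e = 2" using assms by (simp add: is_tree_def)
    then obtain x y where "e = {x, y}" by (auto simp: card_2_iff)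
    then have "\<exists>u. e = {u, v}" using e by (metis insert_commute insertE singletonD)
    then obtain u where "e = {u, v}" ..
    then show "e \<in> (\<lambda>u. {u, v}) ` nbrs H v" using e by blast
  qed
  ultimately show ?thesis by (simp only: degree_at_def)
qed

lemma linking_matrix_carrier [simp]: "linking_matrix H \<in> carrier_mat (num_verts H) (num_verts H)"
  by (simp add: linking_matrix_def)

lemma linking_matrix_dim [simp]:
  "dim_row (linking_matrix H) = num_verts H" "dim_col (linking_matrix H) = num_verts H"
  by (simp_all add: linking_matrix_def)

lemma linking_matrix_mult_vec:
  assumes "is_tree H" "y \<in> carrier_vec (num_verts H)" "v < num_verts H"
  shows "(linking_matrix H *\<^sub>v y) $ v = weights H ! v * y $ v + (\<Sum>u\<in>nbrs H v. y $ u)"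
proof -
  have nb: "nbrs H v \<subseteq> {..<num_verts H} - {v}" using edge_in_verts[OF assms(1)] by blast
  have M_nbr: "linking_matrix H $$ (v, u) = 1" if u: "u \<in> nbrs H v" for u
  proof -
    have "u < num_verts H" "u \<noteq> v" "{v, u} \<in> edges H" using u nb by (auto simp: insert_commute)
    then show ?thesis using assms(3) by (simp add: linking_matrix_def)
  qed
  have M_other: "linking_matrix H $$ (v, u) = 0" if "u < num_verts H" "u \<noteq> v" "u \<notin> nbrs H v" for u
  proof -
    have "{v, u} \<notin> edges H" using that(3) by (simp add: insert_commute)
    then show ?thesis using that assms(3) by (simp add: linking_matrix_def)
  qed
  have "(linking_matrix H *\<^sub>v y) $ v = (\<Sum>u<num_verts H. linking_matrix H $$ (v, u) * y $ u)"
    using assms by (simp add: scalar_prod_def lessThan_atLeast0)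
  also have "\<dots> = weights H ! v * y $ v + (\<Sum>u\<in>{..<num_verts H} - {v}. linking_matrix H $$ (v, u) * y $ u)"
    using assms(3) by (subst sum.remove[of _ v]) (auto simp: linking_matrix_def)
  also have "(\<Sum>u\<in>{..<num_verts H} - {v}. linking_matrix H $$ (v, u) * y $ u)
      = (\<Sum>u\<in>nbrs H v. linking_matrix H $$ (v, u) * y $ u)"
    using nb by (intro sum.mono_neutral_right) (auto simp: M_other)
  also have "\<dots> = (\<Sum>u\<in>nbrs H v. y $ u)"
    by (intro sum.cong refl) (simp only: M_nbr mult_1)
  finally show ?thesis .
qed

lemma symmetric_linking_matrix: "symmetric_mat (map_mat real_of_int (linking_matrix H))"
  by (auto simp: symmetric_mat_def linking_matrix_def insert_commute)

text \<open>Off the diagonal a linking matrix is nonnegative. A strictly positive kernel vector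
  therefore writes the form as minus a sum of weighted squares, one for each edge, and settles
  definiteness with no computation of minors.\<close>

locale plumbing_with_positive_kernel =
  fixes H :: plumbing_graph and u :: "int vec"
  assumes tree: "is_tree H" and marked: "marked H \<in> verts H"
    and u_carrier: "u \<in> carrier_vec (num_verts H)"
    and u_pos: "\<And>v. v < num_verts H \<Longrightarrow> u $ v > 0"
    and ker: "linking_matrix H *\<^sub>v u = 0\<^sub>v (num_verts H)"
begin

abbreviation "N \<equiv> num_verts H"
abbreviation "A \<equiv> map_mat real_of_int (linking_matrix H)"
definition U :: "nat \<Rightarrow> real" where "U v = of_int (u $ v)"

lemma A_carrier: "A \<in> carrier_mat N N" by simp

lemma A_ker: "i < N \<Longrightarrow> (\<Sum>j<N. A $$ (i, j) * U j) = 0"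
proof -
  assume i: "i < N"
  have "(linking_matrix H *\<^sub>v u) $ i = (\<Sum>j<N. linking_matrix H $$ (i, j) * u $ j)"
    using i u_carrier by (simp add: scalar_prod_def lessThan_atLeast0)
  then have "(\<Sum>j<N. linking_matrix H $$ (i, j) * u $ j) = 0" using ker i by simp
  then have "real_of_int (\<Sum>j<N. linking_matrix H $$ (i, j) * u $ j) = 0" by simp
  then show ?thesis using i by (simp add: U_def)
qed

lemma det_zero: "det (linking_matrix H) = 0"
proof -
  have "u \<noteq> 0\<^sub>v N" using marked u_pos[of "marked H"] by (auto simp: verts_def)
  then show ?thesis
    using det_0_iff_vec_prod_zero[OF linking_matrix_carrier, of H] ker u_carrier by blast
qed

definition edge_term :: "real vec \<Rightarrow> nat \<Rightarrow> nat \<Rightarrow> real" where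
  "edge_term x i j = A $$ (i, j) * U i * U j * (x $ i / U i - x $ j / U j)\<^sup>2"

lemma form:
  assumes "x \<in> carrier_vec N"
  shows "x \<bullet> (A *\<^sub>v x) = - (\<Sum>i<N. \<Sum>j<N. edge_term x i j) / 2"
  unfolding edge_term_def
  by (rule quadratic_form_positive_kernel[OF A_carrier symmetric_linking_matrix _ A_ker assms])
    (simp_all add: U_def u_pos)

lemma edge_term_nonneg:
  assumes "i < N" "j < N"
  shows "edge_term x i j \<ge> 0"
\<comment> \<open>A diagonal entry may be negative, but its squared difference vanishes.\<close>
proof (cases "i = j")
  case False
  then have "A $$ (i, j) \<ge> 0" using assms by (simp add: linking_matrix_def)
  then show ?thesis using assms u_pos by (simp add: U_def edge_term_def order_less_imp_le)
qed (simp add: edge_term_def)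

lemma neg_semidefinite: "neg_semidefinite A"
  unfolding neg_semidefinite_def
proof
  fix x :: "real vec" assume "x \<in> carrier_vec (dim_row A)"
  then have "x \<in> carrier_vec N" by simp
  moreover have "(\<Sum>i<N. \<Sum>j<N. edge_term x i j) \<ge> 0"
    by (intro sum_nonneg) (simp add: edge_term_nonneg)
  ultimately show "x \<bullet> (A *\<^sub>v x) \<le> 0" by (simp add: form)
qed

text \<open>Equality forces \<open>x / u\<close> to be constant along edges, hence on the whole connected graph.\<close>
lemma form_eq_0_imp:
  assumes x: "x \<in> carrier_vec N" and zero: "x \<bullet> (A *\<^sub>v x) = 0" and vw: "v < N" "w < N"
  shows "x $ v / U v = x $ w / U w"
proof -
  let ?T = "edge_term x"
  have "(\<Sum>i<N. \<Sum>j<N. ?T i j) = 0" using form[OF x] zero by simp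
  then have "\<forall>i<N. (\<Sum>j<N. ?T i j) = 0"
    by (subst (asm) sum_nonneg_eq_0_iff) (auto intro!: sum_nonneg edge_term_nonneg)
  then have T0: "?T i j = 0" if "i < N" "j < N" for i j
    using that sum_nonneg_eq_0_iff[of "{..<N}" "?T i"] edge_term_nonneg by auto
  have edge: "x $ i / U i = x $ j / U j" if "{i, j} \<in> edges H" for i j
  proof -
    have "A $$ (i, j) = 1" "U i > 0" "U j > 0" "i < N" "j < N"
      using that edge_in_verts[OF tree that] by (auto simp: linking_matrix_def U_def u_pos)
    then show ?thesis using T0[of i j] by (simp add: edge_term_def del: index_map_mat)
  qed
  have "(v, w) \<in> {(a, b). {a, b} \<in> edges H}\<^sup>*" using tree vw by (simp add: is_tree_def verts_def)
  then show ?thesis by (induction rule: rtrancl_induct) (auto dest: edge)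
qed

lemma reduced_matrix_eq: "map_mat real_of_int (reduced_matrix H) = mat_delete A (marked H) (marked H)"
  by (rule eq_matI) (auto simp: reduced_matrix_def mat_delete_def linking_matrix_def)

text \<open>The form vanishes only on multiples of \<open>u\<close>, and \<open>u\<close> is nonzero
  at the marked vertex. So the hyperplane of vectors vanishing there contains no nonzero null
  vector.\<close>

lemma reduced_negative_definite: "negative_definite (map_mat real_of_int (reduced_matrix H))"
proof -
  obtain n where n: "N = Suc n" using marked by (cases N) (auto simp: verts_def)
  have A: "A \<in> carrier_mat (Suc n) (Suc n)" and m: "marked H < Suc n"
    using A_carrier marked by (auto simp: n verts_def)
  show ?thesis
    unfolding reduced_matrix_eq negative_definite_def
  proof (intro ballI impI)
    fix x :: "real vec"
    assume "x \<in> carrier_vec (dim_row (mat_delete A (marked H) (marked H)))"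
      and x0: "x \<noteq> 0\<^sub>v (dim_row (mat_delete A (marked H) (marked H)))"
    then have x: "x \<in> carrier_vec n" by (simp add: mat_delete_def n)
    obtain y where y: "y \<in> carrier_vec (Suc n)" "y $ marked H = 0" "x = drop_coord (marked H) y"
      using drop_coord_surj[OF x m] .
    have eq: "x \<bullet> (mat_delete A (marked H) (marked H) *\<^sub>v x) = y \<bullet> (A *\<^sub>v y)"
      using quadratic_form_mat_delete[OF A m y(1,2)] y(3) by simp
    have "y \<bullet> (A *\<^sub>v y) \<noteq> 0"
    proof
      assume *: "y \<bullet> (A *\<^sub>v y) = 0"
      have "y $ v = 0" if "v < N" for v
        using form_eq_0_imp[OF _ *, of v "marked H"] y that m n u_pos[OF that] by (simp add: U_def)
      then have "x = 0\<^sub>v n"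
        using y x m n insert_index_less[OF m] by (intro eq_vecI) (auto simp: drop_coord_def)
      then show False using x0 by (simp add: mat_delete_def n)
    qed
    moreover have "y \<bullet> (A *\<^sub>v y) \<le> 0"
      using neg_semidefinite y n by (simp add: neg_semidefinite_def)
    ultimately show "x \<bullet> (mat_delete A (marked H) (marked H) *\<^sub>v x) < 0" using eq by simp
  qed
qed

lemma eigenvalue_counts:
  assumes "det (reduced_matrix H) \<noteq> 0"
  shows "num_pos_eigenvalues A = 0" "num_neg_eigenvalues A = N - 1"
proof -
  obtain n where n: "N = Suc n" using marked by (cases N) (auto simp: verts_def)
  have A: "A \<in> carrier_mat (Suc n) (Suc n)" and m: "marked H < Suc n"
    using A_carrier marked by (auto simp: n verts_def)
  have "det (mat_delete A (marked H) (marked H)) \<noteq> 0"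
    using assms unfolding reduced_matrix_eq[symmetric] by simp
  then show "num_pos_eigenvalues A = 0" "num_neg_eigenvalues A = N - 1"
    using eigenvalue_counts_neg_semidefinite[OF A symmetric_linking_matrix neg_semidefinite _ m]
      det_zero n by simp_all
qed

end

section \<open>The plumbing tree of a torus knot\<close>

lemma chain_recurrence:
  assumes "\<forall>i<length ks. z i = ks ! i * z (Suc i) - z (Suc (Suc i))"
  shows "(z 0, z 1) = chain (z (length ks)) (z (Suc (length ks))) ks"
  using assms
proof (induction ks arbitrary: z)
  case (Cons k ks)
  have "(z (Suc 0), z (Suc 1)) = chain (z (Suc (length ks))) (z (Suc (Suc (length ks)))) ks"
    using Cons.IH[of "\<lambda>i. z (Suc i)"] Cons.prems by fastforce
  moreover have "z 0 = k * z 1 - z (Suc 1)" using Cons.prems by fastforce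
  ultimately show ?case by (metis One_nat_def chain.simps(2) fst_conv length_Cons snd_conv)
qed simp

text \<open>Solving a leg from its leaf inwards needs no division and leaves one integer parameter,
  the value at the leaf. The particular solution \<open>P\<close>, \<open>P'\<close> is chosen
  before \<alpha>, so the two values next to the centre depend affinely on \<alpha>. The last
  condition is a virtual 0 beyond the leaf.\<close>

lemma chain_solve:
  "\<exists>P P'. \<forall>\<alpha>. \<exists>y. y 0 = \<alpha> * cf_num ks + P \<and> y 1 = \<alpha> * cf_den ks + P' \<and>
     (\<forall>i<length ks. y i - ks ! i * y (Suc i) + y (Suc (Suc i)) = c i) \<and> y (Suc (length ks)) = (0 :: int)"
proof (induction ks arbitrary: c)
  case Nil
  show ?case
    by (rule exI[of _ 0], rule exI[of _ 0], rule allI, rule_tac x = "\<lambda>i. if i = 0 then \<alpha> else 0" in exI) simp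
next
  case (Cons k ks)
  obtain P P' where *: "\<forall>\<alpha>. \<exists>y. y 0 = \<alpha> * cf_num ks + P \<and> y 1 = \<alpha> * cf_den ks + P' \<and>
     (\<forall>i<length ks. y i - ks ! i * y (Suc i) + y (Suc (Suc i)) = c (Suc i)) \<and> y (Suc (length ks)) = 0"
    using Cons.IH[of "\<lambda>i. c (Suc i)"] by blast
  show ?case
  proof (rule exI[of _ "c 0 + k * P - P'"], rule exI[of _ P], rule allI)
    fix \<alpha>
    obtain y where y: "y 0 = \<alpha> * cf_num ks + P" "y 1 = \<alpha> * cf_den ks + P'"
      "\<forall>i<length ks. y i - ks ! i * y (Suc i) + y (Suc (Suc i)) = c (Suc i)" "y (Suc (length ks)) = 0"
      using * by blast
    define z where "z = case_nat (c 0 + k * y 0 - y 1) y"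
    have z: "z 0 = c 0 + k * y 0 - y 1" "z (Suc i) = y i" for i by (simp_all add: z_def)
    show "\<exists>y. y 0 = \<alpha> * cf_num (k # ks) + (c 0 + k * P - P') \<and> y 1 = \<alpha> * cf_den (k # ks) + P \<and>
      (\<forall>i<length (k # ks). y i - (k # ks) ! i * y (Suc i) + y (Suc (Suc i)) = c i) \<and> y (Suc (length (k # ks))) = 0"
    proof (intro exI[of _ z] conjI allI impI)
      show "z 0 = \<alpha> * cf_num (k # ks) + (c 0 + k * P - P')" using y z by (simp add: algebra_simps)
      show "z 1 = \<alpha> * cf_den (k # ks) + P" using y z(2)[of 0] by simp
      show "z (Suc (length (k # ks))) = 0" using y z by simp
      fix i assume "i < length (k # ks)"
      then show "z i - (k # ks) ! i * z (Suc i) + z (Suc (Suc i)) = c i"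
        using y z by (cases i) auto
    qed
  qed
qed

lemma cf_den_drop: "cf_den (drop i ks) = (if i < length ks then cf_num (drop (Suc i) ks) else 0)"
  by (simp add: Cons_nth_drop_Suc[symmetric])

lemma cf_num_drop:
  assumes "i < length ks"
  shows "cf_num (drop i ks) = ks ! i * cf_num (drop (Suc i) ks) - cf_den (drop (Suc i) ks)"
  using assms by (simp add: Cons_nth_drop_Suc[symmetric])

text \<open>Here \<open>cf_den ks\<close> and \<open>cf_den ls\<close> play the roles of t' and s'.
  Their congruences enter only through the single equation \<open>recip\<close>.\<close>

locale torus_legs =
  fixes s t :: int and ks ls :: "int list"
  assumes s: "s > 1" and t: "t > 1"
    and ks: "ks \<noteq> []" "\<forall>k\<in>set ks. k \<ge> 2" "cf_num ks = t"
    and ls: "ls \<noteq> []" "\<forall>l\<in>set ls. l \<ge> 2" "cf_num ls = s"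
    and recip: "s * cf_den ks + t * cf_den ls = s * t - 1"
begin

definition a :: nat where "a = length ks"
definition b :: nat where "b = length ls"

definition G :: plumbing_graph where
  "G = \<lparr>weights = [- 1] @ map uminus ks @ map uminus ls @ [- (s * t)],
        edges = {{0, 1}, {0, a + 1}, {0, a + b + 1}}
           \<union> {{i, i + 1} | i. 1 \<le> i \<and> i < a}
           \<union> {{i, i + 1} | i. a + 1 \<le> i \<and> i < a + b},
        marked = a + b + 1\<rparr>"

lemma ab_pos: "a \<ge> 1" "b \<ge> 1"
  using ks(1) ls(1) by (simp_all add: a_def b_def Suc_leI)

lemma num_verts_G [simp]: "num_verts G = a + b + 2"
  by (simp add: num_verts_def G_def a_def b_def)

lemma marked_G [simp]: "marked G = a + b + 1"
  by (simp add: G_def)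

text \<open>Rooting the tree at the centre gives one edge for each other vertex. With
  \<open>parent i < i\<close>, connectedness is a descent to 0 and the edges are counted by their
  outer ends.\<close>

definition parent :: "nat \<Rightarrow> nat" where
  "parent i = (if i = 1 \<or> i = a + 1 \<or> i = a + b + 1 then 0 else i - 1)"

lemma parent_less: "i \<ge> 1 \<Longrightarrow> parent i < i"
  by (auto simp: parent_def)

lemma edges_G: "edges G = (\<lambda>i. {parent i, i}) ` {1..a + b + 1}"
proof
  show "edges G \<subseteq> (\<lambda>i. {parent i, i}) ` {1..a + b + 1}"
  proof
    fix e assume "e \<in> edges G"
    then consider "e = {0, 1}" | "e = {0, a + 1}" | "e = {0, a + b + 1}"
      | i where "e = {i, i + 1}" "1 \<le> i" "i < a" | i where "e = {i, i + 1}" "a + 1 \<le> i" "i < a + b"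
      by (auto simp: G_def)
    then show "e \<in> (\<lambda>i. {parent i, i}) ` {1..a + b + 1}"
    proof cases
      case 1
      then show ?thesis by (intro image_eqI[of _ _ 1]) (auto simp: parent_def)
    next
      case 2
      then show ?thesis by (intro image_eqI[of _ _ "a + 1"]) (auto simp: parent_def)
    next
      case 3
      then show ?thesis by (intro image_eqI[of _ _ "a + b + 1"]) (auto simp: parent_def)
    next
      case (4 i)
      then show ?thesis by (intro image_eqI[of _ _ "i + 1"]) (auto simp: parent_def)
    next
      case (5 i)
      then show ?thesis by (intro image_eqI[of _ _ "i + 1"]) (auto simp: parent_def)
    qed
  qed
  show "(\<lambda>i. {parent i, i}) ` {1..a + b + 1} \<subseteq> edges G"
  proof safe
    fix i assume i: "i \<in> {1..a + b + 1}"
    then consider "i = 1" | "i = a + 1" | "i = a + b + 1" | j where "i = j + 1" "1 \<le> j" "j < a"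
      | j where "i = j + 1" "a + 1 \<le> j" "j < a + b"
      by (cases i) (force simp: not_less less_Suc_eq_le)+
    then show "{parent i, i} \<in> edges G"
      by cases (auto simp: parent_def G_def)
  qed
qed

lemma edge_iff:
  "{u, v} \<in> edges G \<longleftrightarrow> v \<in> {1..a + b + 1} \<and> u = parent v \<or> u \<in> {1..a + b + 1} \<and> v = parent u"
  unfolding edges_G by (auto simp: image_iff doubleton_eq_iff)

lemma tree_G: "is_tree G"
  unfolding is_tree_def
proof (intro conjI ballI)
  fix e assume "e \<in> edges G"
  then obtain i where "e = {parent i, i}" "i \<in> {1..a + b + 1}" by (auto simp: edges_G)
  then show "e \<subseteq> verts G" "card e = 2" using parent_less[of i] by (auto simp: verts_def card_2_iff)
next
  let ?R = "{(x, y). {x, y} \<in> edges G}"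
  have sym: "sym (?R\<^sup>*)" by (rule sym_rtrancl) (auto simp: sym_def insert_commute)
  have root: "(v, 0) \<in> ?R\<^sup>*" if "v \<in> verts G" for v
    using that
  proof (induction v rule: less_induct)
    case (less v)
    show ?case
    proof (cases "v = 0")
      case False
      then have "(v, parent v) \<in> ?R" "parent v < v" "parent v \<in> verts G"
        using less.prems parent_less[of v] by (auto simp: verts_def edge_iff)
      then show ?thesis using less.IH by (meson converse_rtrancl_into_rtrancl)
    qed simp
  qed
  fix u v assume "u \<in> verts G" "v \<in> verts G"
  then show "(u, v) \<in> ?R\<^sup>*" using root sym by (meson rtrancl_trans symD)
next
  have "inj_on (\<lambda>i. {parent i, i}) {1..a + b + 1}"
  proof (rule inj_onI)
    fix x y assume "x \<in> {1..a + b + 1}" "y \<in> {1..a + b + 1}" "{parent x, x} = {parent y, y}"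
    then show "x = y" using parent_less[of x] parent_less[of y] by (simp add: doubleton_eq_iff) linarith
  qed
  then show "card (edges G) + 1 = num_verts G" unfolding edges_G by (simp add: card_image)
qed

lemma nbrs_0: "nbrs G 0 = {1, a + 1, a + b + 1}"
  using parent_less by (fastforce simp: edge_iff parent_def split: if_splits)

lemma nbrs_A: "i < a \<Longrightarrow> nbrs G (Suc i) = insert i (if Suc i < a then {Suc (Suc i)} else {})"
  using ab_pos by (auto simp: edge_iff parent_def split: if_splits)

lemma nbrs_B:
  "j < b \<Longrightarrow> nbrs G (a + Suc j) =
    insert (if j = 0 then 0 else a + j) (if Suc j < b then {a + Suc (Suc j)} else {})"
  using ab_pos by (auto simp: edge_iff parent_def split: if_splits)

lemma nbrs_marked: "nbrs G (a + b + 1) = {0}"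
  using ab_pos by (auto simp: edge_iff parent_def split: if_splits)

lemma vertex_cases:
  assumes "v < a + b + 1"
  obtains "v = 0" | i where "i < a" "v = Suc i" | j where "j < b" "v = a + Suc j"
proof (cases "v \<le> a")
  case True
  then show thesis using that by (cases v) auto
next
  case False
  then have "v - a - 1 < b" "v = a + Suc (v - a - 1)" using assms by auto
  then show thesis using that by blast
qed

lemma degree_G:
  "degree_at G 0 = 3" "degree_at G (a + b + 1) = 1"
  "i < a \<Longrightarrow> degree_at G (Suc i) = (if Suc i < a then 2 else 1)"
  "j < b \<Longrightarrow> degree_at G (a + Suc j) = (if Suc j < b then 2 else 1)"
  using ab_pos by (simp_all add: degree_at_eq_card_nbrs[OF tree_G] nbrs_0 nbrs_marked[simplified] nbrs_A
    nbrs_B[simplified])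

lemma weights_G:
  "weights G ! 0 = - 1" "weights G ! (a + b + 1) = - (s * t)"
  "i < a \<Longrightarrow> weights G ! Suc i = - ks ! i"
  "j < b \<Longrightarrow> weights G ! (a + Suc j) = - ls ! j"
  by (simp_all add: G_def nth_append a_def b_def)

lemma sum_list_weights_G: "sum_list (weights G) = - 1 - sum_list ks - sum_list ls - s * t"
  by (simp add: G_def uminus_sum_list_map[symmetric, of id, simplified])

text \<open>Each leg is read as a sequence with the centre at index 0 and the value 0 just past the
  leaf, so that all its rows take the same form in \<open>rows\<close>. For the second leg index 0
  needs its own case, since vertex \<open>a\<close> is the leaf of the first leg.\<close>

definition legA :: "int vec \<Rightarrow> nat \<Rightarrow> int" where
  "legA y i = (if i \<le> a then y $ i else 0)"
definition legB :: "int vec \<Rightarrow> nat \<Rightarrow> int" where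
  "legB y j = (if j = 0 then y $ 0 else if j \<le> b then y $ (a + j) else 0)"

abbreviation "M \<equiv> linking_matrix G"

lemma rows:
  assumes y: "y \<in> carrier_vec (a + b + 2)"
  shows "(M *\<^sub>v y) $ 0 = - y $ 0 + legA y 1 + legB y 1 + y $ (a + b + 1)"
    and "(M *\<^sub>v y) $ (a + b + 1) = y $ 0 - s * t * y $ (a + b + 1)"
    and "i < a \<Longrightarrow> (M *\<^sub>v y) $ Suc i = legA y i - ks ! i * legA y (Suc i) + legA y (Suc (Suc i))"
    and "j < b \<Longrightarrow> (M *\<^sub>v y) $ (a + Suc j) = legB y j - ls ! j * legB y (Suc j) + legB y (Suc (Suc j))"
proof -
  have y': "y \<in> carrier_vec (num_verts G)" using y by simp
  note row = linking_matrix_mult_vec[OF tree_G y']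
  show "(M *\<^sub>v y) $ 0 = - y $ 0 + legA y 1 + legB y 1 + y $ (a + b + 1)"
    using ab_pos by (simp add: row nbrs_0[simplified] weights_G legA_def legB_def del: index_mult_mat_vec)
  show "(M *\<^sub>v y) $ (a + b + 1) = y $ 0 - s * t * y $ (a + b + 1)"
    using row[of "a + b + 1"] by (simp add: nbrs_marked[simplified] weights_G[simplified] del: index_mult_mat_vec)
  show "(M *\<^sub>v y) $ Suc i = legA y i - ks ! i * legA y (Suc i) + legA y (Suc (Suc i))" if "i < a"
    using row[of "Suc i"] that by (simp add: nbrs_A weights_G legA_def del: index_mult_mat_vec)
  show "(M *\<^sub>v y) $ (a + Suc j) = legB y j - ls ! j * legB y (Suc j) + legB y (Suc (Suc j))" if "j < b"
    using row[of "a + Suc j"] that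
    by (simp add: nbrs_B[simplified] weights_G[simplified] legB_def del: index_mult_mat_vec)
qed

text \<open>Normalised to 1 at the marked vertex, whose row then forces st at the centre. On each
  leg the homogeneous recurrence is solved by the numerators of the remaining tails, scaled to agree
  with st at the centre. The row of the centre is then \<open>recip\<close>.\<close>

definition kernel_vec :: "int vec" where
  "kernel_vec = vec (a + b + 2) (\<lambda>v. if v \<le> a then s * cf_num (drop v ks)
     else if v \<le> a + b then t * cf_num (drop (v - a) ls) else 1)"

lemma legA_kernel: "legA kernel_vec i = (if i \<le> a then s * cf_num (drop i ks) else 0)"
  by (simp add: legA_def kernel_vec_def)

lemma legB_kernel: "legB kernel_vec j = (if j \<le> b then t * cf_num (drop j ls) else 0)"
  using ks(3) ls(3) by (simp add: legB_def kernel_vec_def)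

lemma kernel_vec_carrier: "kernel_vec \<in> carrier_vec (a + b + 2)"
  by (simp add: kernel_vec_def)

lemma kernel: "M *\<^sub>v kernel_vec = 0\<^sub>v (a + b + 2)"
proof (rule eq_vecI)
  fix v assume "v < dim_vec (0\<^sub>v (a + b + 2) :: int vec)"
  then have v: "v < a + b + 1 \<or> v = a + b + 1" by auto
  note r = rows[OF kernel_vec_carrier]
  have u0: "kernel_vec $ 0 = s * t" "kernel_vec $ (a + b + 1) = 1"
    using ks(3) by (simp_all add: kernel_vec_def)
  have "(M *\<^sub>v kernel_vec) $ v = 0"
    using v
  proof
    assume "v < a + b + 1"
    then show ?thesis
    proof (cases rule: vertex_cases)
      case 1
      have "cf_den ks = cf_num (drop 1 ks)" "cf_den ls = cf_num (drop 1 ls)"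
        using cf_den_drop[of 0 ks] cf_den_drop[of 0 ls] ks(1) ls(1) by auto
      then show ?thesis
        unfolding 1 r(1) u0 legA_kernel legB_kernel using ab_pos recip by simp
    next
      case (2 i)
      then have *: "cf_num (drop i ks) = ks ! i * cf_num (drop (Suc i) ks)
          - (if Suc i < a then cf_num (drop (Suc (Suc i)) ks) else 0)"
        using cf_num_drop[of i ks] cf_den_drop[of "Suc i" ks] by (simp add: a_def)
      then show ?thesis
        unfolding 2(2) r(3)[OF 2(1)] legA_kernel * using 2(1) by (auto simp: algebra_simps)
    next
      case (3 j)
      then have *: "cf_num (drop j ls) = ls ! j * cf_num (drop (Suc j) ls)
          - (if Suc j < b then cf_num (drop (Suc (Suc j)) ls) else 0)"
        using cf_num_drop[of j ls] cf_den_drop[of "Suc j" ls] by (simp add: b_def)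
      then show ?thesis
        unfolding 3(2) r(4)[OF 3(1)] legB_kernel * using 3(1) by (auto simp: algebra_simps)
    qed
  next
    assume "v = a + b + 1"
    then show ?thesis unfolding \<open>v = a + b + 1\<close> r(2) u0 by simp
  qed
  then show "(M *\<^sub>v kernel_vec) $ v = 0\<^sub>v (a + b + 2) $ v" using v by auto
qed simp

lemma kernel_vec_pos: "v < a + b + 2 \<Longrightarrow> kernel_vec $ v > 0"
proof -
  assume v: "v < a + b + 2"
  have "cf_num (drop i ks) > 0" "cf_num (drop i ls) > 0" for i
    using cf_den_bounds[of "drop i ks"] cf_den_bounds[of "drop i ls"] ks(2) ls(2)
    by (meson in_set_dropD order_le_less_trans)+
  then show ?thesis using v s t by (simp add: kernel_vec_def)
qed

sublocale plumbing_with_positive_kernel G kernel_vec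
  by unfold_locales
    (use tree_G kernel_vec_carrier kernel kernel_vec_pos in \<open>auto simp: verts_def\<close>)

section \<open>Integral solvability and unimodularity\<close>

definition lattice :: "int vec set" where
  "lattice = {y \<in> carrier_vec (a + b + 2). y $ (a + b + 1) = 0}"

text \<open>After eliminating the legs, two unknowns remain, the values at the leaves. They satisfy
  two equations: both legs must give the same value at the centre, and the row of the centre must
  hold.\<close>

lemma solvable: "\<exists>y\<in>lattice. \<forall>v<a + b + 1. (M *\<^sub>v y) $ v = c v"
proof -
  obtain P P' where A: "\<And>\<alpha>. \<exists>y. y 0 = \<alpha> * t + P \<and> y 1 = \<alpha> * cf_den ks + P' \<and>
     (\<forall>i<a. y i - ks ! i * y (Suc i) + y (Suc (Suc i)) = c (Suc i)) \<and> y (Suc a) = (0 :: int)"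
    using chain_solve[of ks "\<lambda>i. c (Suc i)"] ks(3) unfolding a_def by auto
  obtain Q Q' where B: "\<And>\<beta>. \<exists>y. y 0 = \<beta> * s + Q \<and> y 1 = \<beta> * cf_den ls + Q' \<and>
     (\<forall>j<b. y j - ls ! j * y (Suc j) + y (Suc (Suc j)) = c (a + Suc j)) \<and> y (Suc b) = (0 :: int)"
    using chain_solve[of ls "\<lambda>j. c (a + Suc j)"] ls(3) unfolding b_def by auto
  define t' s' where "t' = cf_den ks" and "s' = cf_den ls"
  \<comment> \<open>This is the determinant of the resulting 2 by 2 system, and \<open>recip\<close>
    makes it -1. So Cramer's rule, which gives \<alpha> and \<beta> below, stays within the
    integers.\<close>
  have det: "t * s' + s * (t' - t) = - 1" using recip by (simp add: t'_def s'_def algebra_simps)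
  define X Y where "X = Q - P" and "Y = c 0 + P - P' - Q'"
  define \<alpha> \<beta> where "\<alpha> = - (s' * X + s * Y)" and "\<beta> = - (t * Y - (t' - t) * X)"
  have "t * \<alpha> - s * \<beta> = - (t * s' + s * (t' - t)) * X" by (simp add: \<alpha>_def \<beta>_def algebra_simps)
  then have eq1: "\<alpha> * t + P = \<beta> * s + Q" unfolding det by (simp add: X_def algebra_simps)
  have "(t' - t) * \<alpha> + s' * \<beta> = - (t * s' + s * (t' - t)) * Y" by (simp add: \<alpha>_def \<beta>_def algebra_simps)
  then have eq2: "- (\<alpha> * t + P) + (\<alpha> * t' + P') + (\<beta> * s' + Q') = c 0"
    unfolding det by (simp add: Y_def algebra_simps)
  obtain f where f: "f 0 = \<alpha> * t + P" "f 1 = \<alpha> * t' + P'"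
     "\<And>i. i < a \<Longrightarrow> f i - ks ! i * f (Suc i) + f (Suc (Suc i)) = c (Suc i)" "f (Suc a) = (0 :: int)"
    using A[of \<alpha>] unfolding t'_def by blast
  obtain g where g: "g 0 = \<beta> * s + Q" "g 1 = \<beta> * s' + Q'"
     "\<And>j. j < b \<Longrightarrow> g j - ls ! j * g (Suc j) + g (Suc (Suc j)) = c (a + Suc j)" "g (Suc b) = (0 :: int)"
    using B[of \<beta>] unfolding s'_def by blast
  define y where "y = vec (a + b + 2) (\<lambda>v. if v \<le> a then f v else if v \<le> a + b then g (v - a) else 0)"
  have y: "y \<in> carrier_vec (a + b + 2)" by (simp add: y_def)
  have lA: "legA y i = f i" if "i \<le> Suc a" for i
    using that f(4) by (auto simp: legA_def y_def le_Suc_eq)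
  have lB: "legB y j = g j" if "j \<le> Suc b" for j
    using that g(1,4) f(1) eq1 by (auto simp: legB_def y_def le_Suc_eq)
  have y0: "y $ 0 = f 0" "y $ (a + b + 1) = 0" by (simp_all add: y_def)
  have "(M *\<^sub>v y) $ v = c v" if "v < a + b + 1" for v
    using that
  proof (cases rule: vertex_cases)
    case 1
    then show ?thesis using rows(1)[OF y] lA[of 1] lB[of 1] ab_pos eq2 f(1,2) g(2) y0 by simp
  next
    case (2 i)
    then show ?thesis using rows(3)[OF y 2(1)] f(3)[OF 2(1)] lA by simp
  next
    case (3 j)
    then show ?thesis using rows(4)[OF y 3(1)] g(3)[OF 3(1)] lB by simp
  qed
  moreover have "y \<in> lattice" using y y0 by (simp add: lattice_def)
  ultimately show ?thesis by blast
qed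

lemma drop_coord_index:
  "y \<in> carrier_vec (a + b + 2) \<Longrightarrow> v < a + b + 1 \<Longrightarrow> drop_coord (a + b + 1) y $ v = y $ v"
  by (simp add: drop_coord_def insert_index_def)

lemma reduced_carrier: "reduced_matrix G \<in> carrier_mat (a + b + 1) (a + b + 1)"
  using mat_delete_carrier[OF linking_matrix_carrier[of G]] by (simp add: reduced_matrix_def)

lemma reduced_mult:
  assumes "y \<in> lattice"
  shows "reduced_matrix G *\<^sub>v drop_coord (a + b + 1) y = drop_coord (a + b + 1) (M *\<^sub>v y)"
  using mat_delete_mult_drop_coord[of M "a + b + 1" "a + b + 1" y] assms linking_matrix_carrier[of G]
  by (simp add: reduced_matrix_def lattice_def)

lemma abs_det_reduced: "\<bar>det (reduced_matrix G)\<bar> = 1"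
proof (rule abs_det_eq_1_if_surj[OF reduced_carrier])
  fix w :: "int vec" assume w: "w \<in> carrier_vec (a + b + 1)"
  obtain y where y: "y \<in> lattice" "\<forall>v<a + b + 1. (M *\<^sub>v y) $ v = w $ v"
    using solvable[of "\<lambda>v. w $ v"] by blast
  have y': "y \<in> carrier_vec (Suc (a + b + 1))" using y by (simp add: lattice_def)
  have My: "M *\<^sub>v y \<in> carrier_vec (a + b + 2)"
    using mult_mat_vec_carrier[OF linking_matrix_carrier[of G], of y] y' by simp
  have "drop_coord (a + b + 1) (M *\<^sub>v y) = w"
  proof (rule eq_vecI)
    fix v assume "v < dim_vec w"
    then have v: "v < a + b + 1" using w by (simp only: carrier_vecD)
    then show "drop_coord (a + b + 1) (M *\<^sub>v y) $ v = w $ v"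
      unfolding drop_coord_index[OF My v] using y(2) by blast
  next
    show "dim_vec (drop_coord (a + b + 1) (M *\<^sub>v y)) = dim_vec w"
      using carrier_vecD[OF w] carrier_vecD[OF My] by (simp only: drop_coord_def dim_vec)
  qed
  then show "\<exists>x\<in>carrier_vec (a + b + 1). reduced_matrix G *\<^sub>v x = w"
    using reduced_mult[OF y(1)] drop_coord_carrier[OF y'] by metis
qed

sublocale plumbed_knot G
proof unfold_locales
  show "is_tree G" by (rule tree_G)
  show "marked G \<in> verts G" by (simp add: verts_def)
  show "degree_at G (marked G) = 1" using degree_G(2) by simp
  show "negative_definite (map_mat real_of_int (reduced_matrix G))" by (rule reduced_negative_definite)
  show "\<bar>det (reduced_matrix G)\<bar> = 1" by (rule abs_det_reduced)
  show "det (linking_matrix G) = 0" by (rule det_zero)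
qed

end

section \<open>Evaluation of the series\<close>

lemma formal_sum_single:
  assumes "j \<in> I" "\<And>i. i \<in> I \<Longrightarrow> i \<noteq> j \<Longrightarrow> f i x e = 0"
  shows "formal_sum I f x e = f j x e"
proof (cases "f j x e = 0")
  case True
  then have "{i \<in> I. f i x e \<noteq> 0} = {}" using assms by auto
  then show ?thesis unfolding formal_sum_def by (simp only: sum.empty True)
next
  case False
  then have "{i \<in> I. f i x e \<noteq> 0} = {j}" using assms by auto
  then show ?thesis unfolding formal_sum_def by simp
qed

lemma formal_sum_zero:
  assumes "\<And>i. i \<in> I \<Longrightarrow> f i x e = 0"
  shows "formal_sum I f x e = 0"
  unfolding formal_sum_def using assms by (intro sum.neutral) auto

text \<open>The residues carrying the same sign come in pairs with sum 2st, which negation swaps.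
  This allows an index of either sign.\<close>

lemma torus_eps_uminus: "torus_eps s t (- m) = torus_eps s t m"
proof -
  have *: "[- m = x] (mod 2 * s * t) \<longleftrightarrow> [m = y] (mod 2 * s * t)" if "x + y = 2 * s * t" for x y
  proof -
    have "- m - x = - (m - y) - 2 * s * t" using that by simp
    then show ?thesis unfolding cong_iff_dvd_diff
      by (metis dvd_diff_right_iff dvd_minus_iff dvd_refl dvd_diff_left_iff)
  qed
  have "[- m = s * t + s + t] (mod 2 * s * t) \<longleftrightarrow> [m = s * t - s - t] (mod 2 * s * t)"
    "[- m = s * t - s - t] (mod 2 * s * t) \<longleftrightarrow> [m = s * t + s + t] (mod 2 * s * t)"
    "[- m = s * t + s - t] (mod 2 * s * t) \<longleftrightarrow> [m = s * t - s + t] (mod 2 * s * t)"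
    "[- m = s * t - s + t] (mod 2 * s * t) \<longleftrightarrow> [m = s * t + s - t] (mod 2 * s * t)"
    by (rule *; simp)+
  then show ?thesis by (simp add: torus_eps_def disj_commute)
qed

text \<open>As \<open>c\<close> is odd, the argument is st - s e1 - t e2 modulo 2st, so the two
  signs select one of the four residues.\<close>

lemma torus_eps_odd_multiple:
  fixes s t c e1 e2 :: int
  assumes "s > 1" "t > 1" "odd c" "e1 = 1 \<or> e1 = - 1" "e2 = 1 \<or> e2 = - 1"
  shows "torus_eps s t (- (s * t * c + s * e1 + t * e2)) = of_int (- e1 * e2)"
proof -
  define z where "z = - (s * t * c + s * e1 + t * e2)"
  obtain k where "c = 2 * k + 1" using assms(3) by (elim oddE)
  then have "z - (s * t - s * e1 - t * e2) = (2 * s * t) * (- k - 1)" by (simp add: z_def algebra_simps)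
  then have z: "[z = s * t - s * e1 - t * e2] (mod 2 * s * t)" unfolding cong_iff_dvd_diff by simp
  have sub: "[z = w] (mod 2 * s * t) \<longleftrightarrow> 2 * s * t dvd (s * t - s * e1 - t * e2) - w" for w
    unfolding cong_iff_dvd_diff[symmetric] using z by (meson cong_sym cong_trans)
  \<comment> \<open>When the signs differ, the test for the value -1 comes earlier and has to fail.
    The residues then differ by 2s or 2t up to sign, too small to be divisible by 2st.\<close>
  have "2 * s < 2 * s * t" "2 * t < 2 * s * t" using assms(1,2) by simp_all
  then have nd: "\<not> 2 * s * t dvd 2 * s" "\<not> 2 * s * t dvd 2 * t"
    using assms(1,2) by (auto dest: zdvd_imp_le)
  show ?thesis
    using assms(4,5) unfolding z_def[symmetric] torus_eps_def sub
  proof (elim disjE)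
    assume e: "e1 = 1" "e2 = - 1"
    have "(s * t - s * e1 - t * e2) - (s * t + s + t) = - (2 * s)"
      "(s * t - s * e1 - t * e2) - (s * t - s - t) = 2 * t"
      "(s * t - s * e1 - t * e2) - (s * t - s + t) = 0" by (simp_all add: e)
    then show "(if 2 * s * t dvd (s * t - s * e1 - t * e2) - (s * t + s + t) \<or> 2 * s * t dvd (s * t - s * e1 - t * e2) - (s * t - s - t)
      then - 1 else if 2 * s * t dvd (s * t - s * e1 - t * e2) - (s * t + s - t) \<or> 2 * s * t dvd (s * t - s * e1 - t * e2) - (s * t - s + t)
      then 1 else 0) = (of_int (- e1 * e2) :: rat)"
      using nd by (simp only: dvd_minus_iff dvd_0_right if_False if_True simp_thms) (simp add: e)
  next
    assume e: "e1 = - 1" "e2 = 1"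
    have "(s * t - s * e1 - t * e2) - (s * t + s + t) = - (2 * t)"
      "(s * t - s * e1 - t * e2) - (s * t - s - t) = 2 * s"
      "(s * t - s * e1 - t * e2) - (s * t + s - t) = 0" by (simp_all add: e)
    then show "(if 2 * s * t dvd (s * t - s * e1 - t * e2) - (s * t + s + t) \<or> 2 * s * t dvd (s * t - s * e1 - t * e2) - (s * t - s - t)
      then - 1 else if 2 * s * t dvd (s * t - s * e1 - t * e2) - (s * t + s - t) \<or> 2 * s * t dvd (s * t - s * e1 - t * e2) - (s * t - s + t)
      then 1 else 0) = (of_int (- e1 * e2) :: rat)"
      using nd by (simp only: dvd_minus_iff dvd_0_right if_False if_True simp_thms) (simp add: e)
  qed simp_all
qed

lemma torus_eps_nonzeroE:
  fixes s t z :: int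
  assumes "torus_eps s t z \<noteq> 0"
  obtains c e1 e2 where "odd c" "e1 = 1 \<or> e1 = - 1" "e2 = 1 \<or> e2 = - 1"
    "z = - (s * t * c + s * e1 + t * e2)"
proof -
  have "\<exists>\<sigma> \<tau>. (\<sigma> = 1 \<or> \<sigma> = - 1) \<and> (\<tau> = 1 \<or> \<tau> = - 1) \<and> [z = s * t + s * \<sigma> + t * \<tau>] (mod 2 * s * t)"
    (is "\<exists>\<sigma> \<tau>. ?P \<sigma> \<tau>")
  proof -
    consider "[z = s * t + s + t] (mod 2 * s * t)" | "[z = s * t - s - t] (mod 2 * s * t)"
      | "[z = s * t + s - t] (mod 2 * s * t)" | "[z = s * t - s + t] (mod 2 * s * t)"
      using assms unfolding torus_eps_def by (metis (full_types))
    then have "?P 1 1 \<or> ?P (- 1) (- 1) \<or> ?P 1 (- 1) \<or> ?P (- 1) 1" by cases simp_all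
    then show ?thesis by blast
  qed
  then obtain \<sigma> \<tau> where st: "\<sigma> = 1 \<or> \<sigma> = - 1" "\<tau> = 1 \<or> \<tau> = - 1"
    and "2 * s * t dvd z - (s * t + s * \<sigma> + t * \<tau>)" unfolding cong_iff_dvd_diff by blast
  then obtain k where "z - (s * t + s * \<sigma> + t * \<tau>) = 2 * s * t * k" by (elim dvdE)
  then have "z = - (s * t * (- 1 - 2 * k) + s * (- \<sigma>) + t * (- \<tau>))" by (simp add: algebra_simps)
  moreover have "odd (- 1 - 2 * k)" by simp
  moreover have "- \<sigma> = 1 \<or> - \<sigma> = - 1" "- \<tau> = 1 \<or> - \<tau> = - 1" using st by auto
  ultimately show thesis using that by blast
qed

text \<open>All differences are even. Once halved, those of the signs have absolute value at most 1
  but are divisible by t and s, so they vanish. The halving, which rests on the parity of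
  \<open>c\<close> and \<open>c'\<close>, matters when s or t is 2.\<close>

lemma odd_multiple_unique:
  fixes s t c c' e1 e2 e1' e2' :: int
  assumes st: "s > 1" "t > 1" "coprime s t" and odd: "odd c" "odd c'"
    and e: "e1 = 1 \<or> e1 = - 1" "e2 = 1 \<or> e2 = - 1" "e1' = 1 \<or> e1' = - 1" "e2' = 1 \<or> e2' = - 1"
    and eq: "s * t * c + s * e1 + t * e2 = s * t * c' + s * e1' + t * e2'"
  shows "c = c' \<and> e1 = e1' \<and> e2 = e2'"
proof -
  have "even (c - c')" using odd by simp
  then obtain k where k: "c - c' = 2 * k" by (elim evenE)
  obtain d1 where d1: "e1' - e1 = 2 * d1" "\<bar>d1\<bar> \<le> 1"
    using e that[of 0] that[of 1] that[of "- 1"] by auto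
  obtain d2 where d2: "e2' - e2 = 2 * d2" "\<bar>d2\<bar> \<le> 1"
    using e that[of 0] that[of 1] that[of "- 1"] by auto
  have "s * t * (c - c') = s * (e1' - e1) + t * (e2' - e2)" using eq by (simp add: algebra_simps)
  then have main: "s * t * k = s * d1 + t * d2" unfolding k d1 d2 by simp
  have "s * d1 = t * (s * k - d2)" "t * d2 = s * (t * k - d1)" using main by (simp_all add: algebra_simps)
  then have "t dvd s * d1" "s dvd t * d2" by simp_all
  then have "t dvd d1" "s dvd d2"
    using st(3) by (simp_all add: coprime_dvd_mult_right_iff coprime_commute)
  then have "d1 = 0" "d2 = 0"
    using dvd_imp_le_int[of d1 t] dvd_imp_le_int[of d2 s] d1(2) d2(2) st(1,2) by linarith+
  moreover from this have "k = 0" using main st by simp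
  ultimately show ?thesis using k d1 d2 by simp
qed

text \<open>The last hypothesis trades X for E and F, which cancel against those in Y. Both sides
  then equal (z^2 + s^2 t^2 - s^2 - t^2) / (4 s t).\<close>

lemma exponent_identity:
  fixes s t z E F X Y :: rat
  assumes "s \<noteq> 0" "t \<noteq> 0" "s * t * Y = - z\<^sup>2 - s * E - t * F" "X + (E + s) / t + (F + t) / s = 2"
  shows "- Y / 4 + (X - 2 + s * t) / 4 = (z\<^sup>2 - (s * t - s - t)\<^sup>2) / (4 * s * t) + (s - 1) * (t - 1) / 2"
proof -
  have "s * t * (X + (E + s) / t + (F + t) / s) = s * t * X + s * (E + s) + t * (F + t)"
    using assms(1,2) by (simp add: field_simps)
  then have X: "s * t * X = 2 * (s * t) - s * (E + s) - t * (F + t)" using assms(4) by simp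
  have "4 * s * t * (- Y / 4 + (X - 2 + s * t) / 4) = - (s * t * Y) + s * t * X - 2 * (s * t) + (s * t)\<^sup>2"
    by (simp add: field_simps power2_eq_square)
  also have "\<dots> = (z\<^sup>2 - (s * t - s - t)\<^sup>2) + 2 * (s * t) * ((s - 1) * (t - 1))"
    unfolding X assms(3) by (simp add: algebra_simps power2_eq_square)
  also have "\<dots> = 4 * s * t * ((z\<^sup>2 - (s * t - s - t)\<^sup>2) / (4 * s * t) + (s - 1) * (t - 1) / 2)"
    using assms(1,2) by (simp add: distrib_left)
  finally show ?thesis using assms(1,2) by simp
qed

lemma sum_list_of_int_minus_3: "(\<Sum>k\<leftarrow>ks. of_int k - 3 :: rat) = of_int (sum_list ks - 3 * int (length ks))"
  by (induction ks) simp_all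

section \<open>Coefficients of the closed formula\<close>

definition torus_exponent :: "int \<Rightarrow> int \<Rightarrow> int \<Rightarrow> rat" where
  "torus_exponent s t z =
     of_int (z\<^sup>2 - (s * t - s - t)\<^sup>2) / of_int (4 * s * t) + of_int ((s - 1) * (t - 1)) / 2"

text \<open>One index \<open>z\<close> of either sign replaces the pair of terms x^(m/2) and -
  x^(-m/2): the exponent of x is z / 2, m is the absolute value of z, and \<open>sgn z\<close> is
  the sign of the term.\<close>

definition torus_coeff :: "int \<Rightarrow> int \<Rightarrow> int \<Rightarrow> rat" where
  "torus_coeff s t z = of_int (sgn z) * torus_eps s t z / 2"

definition torus_series :: "int \<Rightarrow> int \<Rightarrow> xq_series" where
  "torus_series s t = q_shift (of_int ((s - 1) * (t - 1)) / 2)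
      (xq_scale (1 / 2)
        (formal_sum {m. m \<ge> 1} (\<lambda>m.
          xq_scale (torus_eps s t m)
            (xq_monom (of_int m / 2)
               (of_int (m\<^sup>2 - (s * t - s - t)\<^sup>2) / of_int (4 * s * t))
             - xq_monom (- (of_int m / 2))
               (of_int (m\<^sup>2 - (s * t - s - t)\<^sup>2) / of_int (4 * s * t))))))"

lemma torus_series_coeff:
  "torus_series s t (of_int z / 2) (torus_exponent s t z) = torus_coeff s t z"
proof -
  define f where "f m = xq_scale (torus_eps s t m)
            (xq_monom (of_int m / 2)
               (of_int (m\<^sup>2 - (s * t - s - t)\<^sup>2) / of_int (4 * s * t))
             - xq_monom (- (of_int m / 2))
               (of_int (m\<^sup>2 - (s * t - s - t)\<^sup>2) / of_int (4 * s * t)))" for m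
  define e :: rat where "e = of_int (z\<^sup>2 - (s * t - s - t)\<^sup>2) / of_int (4 * s * t)"
  have half: "(of_int z / 2 :: rat) = of_int m / 2 \<longleftrightarrow> z = m" for m by simp
  have half': "(of_int z / 2 :: rat) = - (of_int m / 2) \<longleftrightarrow> z = - m" for m
    using half[of "- m"] by (simp only: of_int_minus minus_divide_left)
  have f: "f m (of_int z / 2) e = torus_eps s t m *
    ((if z = m \<and> e = of_int (m\<^sup>2 - (s * t - s - t)\<^sup>2) / of_int (4 * s * t) then 1 else 0)
     - (if z = - m \<and> e = of_int (m\<^sup>2 - (s * t - s - t)\<^sup>2) / of_int (4 * s * t) then 1 else 0))" for m
    by (simp only: f_def xq_scale_def xq_monom_def fun_diff_def half half')
  have f0: "f m (of_int z / 2) e = 0" if "z \<noteq> m" "z \<noteq> - m" for m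
    using that by (simp add: f)
  have "formal_sum {m. m \<ge> 1} f (of_int z / 2) e = of_int (sgn z) * torus_eps s t z"
  proof (cases "z = 0")
    case True
    then have "formal_sum {m. m \<ge> 1} f (of_int z / 2) e = 0" by (intro formal_sum_zero f0) auto
    then show ?thesis using True by simp
  next
    case False
    then have "formal_sum {m. m \<ge> 1} f (of_int z / 2) e = f \<bar>z\<bar> (of_int z / 2) e"
      by (intro formal_sum_single f0) auto
    also have "\<dots> = torus_eps s t \<bar>z\<bar> * ((if z = \<bar>z\<bar> then 1 else 0) - (if z = - \<bar>z\<bar> then 1 else 0))"
      by (simp only: f power2_abs e_def[symmetric] simp_thms)
    also have "\<dots> = torus_eps s t \<bar>z\<bar> * of_int (sgn z)"
      using False by (cases "z > 0") simp_all
    also have "torus_eps s t \<bar>z\<bar> = torus_eps s t z" by (simp add: abs_if torus_eps_uminus)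
    finally show ?thesis by (simp only: mult.commute)
  qed
  then show ?thesis
    unfolding torus_series_def f_def[symmetric] torus_coeff_def
    by (simp add: q_shift_def xq_scale_def torus_exponent_def e_def)
qed

lemma torus_series_eq_0:
  assumes "\<And>z. \<not> (x = of_int z / 2 \<and> e = torus_exponent s t z)"
  shows "torus_series s t x e = 0"
proof -
  have "x \<noteq> of_int m / 2 \<or> e - of_int ((s - 1) * (t - 1)) / 2 \<noteq> of_int (m\<^sup>2 - (s * t - s - t)\<^sup>2) / of_int (4 * s * t)"
    "x \<noteq> - (of_int m / 2) \<or> e - of_int ((s - 1) * (t - 1)) / 2 \<noteq> of_int (m\<^sup>2 - (s * t - s - t)\<^sup>2) / of_int (4 * s * t)" for m
    using assms[of m] assms[of "- m"] unfolding torus_exponent_def power2_minus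
    by (auto simp only: of_int_minus minus_divide_left diff_eq_eq)
  then show ?thesis unfolding torus_series_def q_shift_def xq_scale_def
    by (subst formal_sum_zero) (auto simp: xq_monom_def)
qed

section \<open>Terms of the lattice sum\<close>

context torus_legs begin

lemma unmarked_lattice_eq: "unmarked_lattice = lattice"
  unfolding unmarked_lattice_def lattice_def by simp

lemma latticeD:
  assumes "y \<in> lattice"
  shows "y \<in> carrier_vec (a + b + 2)" "y $ (a + b + 1) = 0"
  using assms by (simp_all add: lattice_def)

lemma M_mult_carrier: "y \<in> lattice \<Longrightarrow> M *\<^sub>v y \<in> carrier_vec (a + b + 2)"
  using mult_mat_vec_carrier[OF linking_matrix_carrier[of G], of y] by (simp add: lattice_def)

lemma M_carrier: "M \<in> carrier_mat (a + b + 2) (a + b + 2)"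
  using linking_matrix_carrier[of G] by simp

lemma lattice_inject:
  assumes y: "y \<in> lattice" "y' \<in> lattice"
    and eq: "\<And>v. v < a + b + 1 \<Longrightarrow> (M *\<^sub>v y) $ v = (M *\<^sub>v y') $ v"
  shows "y = y'"
proof -
  define z where "z = y - y'"
  have "z $ (a + b + 1) = y $ (a + b + 1) - y' $ (a + b + 1)"
    unfolding z_def using carrier_vecD[OF latticeD(1)[OF y(2)]] by (intro index_minus_vec) simp
  then have "z $ (a + b + 1) = 0" by (simp only: latticeD(2)[OF y(1)] latticeD(2)[OF y(2)] diff_self)
  moreover have "z \<in> carrier_vec (a + b + 2)"
    unfolding z_def by (rule minus_carrier_vec[OF latticeD(1)[OF y(1)] latticeD(1)[OF y(2)]])
  ultimately have z: "z \<in> lattice" unfolding lattice_def by blast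
  have zc: "z \<in> carrier_vec (Suc (a + b + 1))" using z by (simp add: lattice_def)
  have Mz: "M *\<^sub>v z = M *\<^sub>v y - M *\<^sub>v y'"
    unfolding z_def by (rule mult_minus_distrib_mat_vec[OF M_carrier latticeD(1)[OF y(1)] latticeD(1)[OF y(2)]])
  have "drop_coord (a + b + 1) (M *\<^sub>v z) = 0\<^sub>v (a + b + 1)"
  proof (rule eq_vecI)
    fix v assume "v < dim_vec (0\<^sub>v (a + b + 1) :: int vec)"
    then have v: "v < a + b + 1" by simp
    have "(M *\<^sub>v z) $ v = (M *\<^sub>v y) $ v - (M *\<^sub>v y') $ v"
      unfolding Mz using v carrier_vecD[OF M_mult_carrier[OF y(2)]] by (intro index_minus_vec) simp
    then have "(M *\<^sub>v z) $ v = 0" using eq[OF v] by simp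
    then show "drop_coord (a + b + 1) (M *\<^sub>v z) $ v = 0\<^sub>v (a + b + 1) $ v"
      unfolding drop_coord_index[OF M_mult_carrier[OF z] v] using v by simp
  next
    show "dim_vec (drop_coord (a + b + 1) (M *\<^sub>v z)) = dim_vec (0\<^sub>v (a + b + 1) :: int vec)"
      using carrier_vecD[OF M_mult_carrier[OF z]] by (simp only: drop_coord_def dim_vec index_zero_vec)
  qed
  then have "reduced_matrix G *\<^sub>v drop_coord (a + b + 1) z = 0\<^sub>v (a + b + 1)"
    using reduced_mult[OF z] by simp
  moreover have "det (reduced_matrix G) \<noteq> 0" using abs_det_reduced by auto
  ultimately have dz: "drop_coord (a + b + 1) z = 0\<^sub>v (a + b + 1)"
    using det_0_iff_vec_prod_zero[OF reduced_carrier] drop_coord_carrier[OF zc] by blast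
  have z0: "z $ v = 0" if "v < a + b + 1" for v
    using drop_coord_index[OF latticeD(1)[OF z] that] that unfolding dz by simp
  show ?thesis
  proof (rule eq_vecI)
    fix v assume "v < dim_vec y'"
    then have "v < a + b + 2" using latticeD(1)[OF y(2)] by simp
    then consider "v < a + b + 1" | "v = a + b + 1" by linarith
    then show "y $ v = y' $ v"
    proof cases
      case 1
      then have "z $ v = y $ v - y' $ v"
        unfolding z_def using carrier_vecD[OF latticeD(1)[OF y(2)]] by (intro index_minus_vec) simp
      then show ?thesis using z0[OF 1] by simp
    next
      case 2
      then show ?thesis using latticeD(2)[OF y(1)] latticeD(2)[OF y(2)] by simp
    qed
  qed (use latticeD(1)[OF y(1)] latticeD(1)[OF y(2)] in simp)
qed

text \<open>The vertices \<open>a\<close> and \<open>a + b\<close> are the leaves of the two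
  legs.\<close>

definition target :: "int \<Rightarrow> int \<Rightarrow> int \<Rightarrow> nat \<Rightarrow> int" where
  "target c e1 e2 v = (if v = 0 then c else if v = a then e1 else if v = a + b then e2 else 0)"

abbreviation "E \<equiv> cf_conum ks"
abbreviation "F \<equiv> cf_conum ls"

lemma target_solution:
  assumes y: "y \<in> lattice" and target: "\<forall>v<a + b + 1. (M *\<^sub>v y) $ v = target c e1 e2 v"
    and e: "e1 * e1 = 1" "e2 * e2 = 1"
  shows "y $ 0 = - (s * t * c + s * e1 + t * e2)"
    and "s * t * (y \<bullet> (M *\<^sub>v y)) = - (y $ 0)\<^sup>2 - s * E - t * F"
    and "(M *\<^sub>v y) $ (a + b + 1) = y $ 0"
proof -
  note r = rows[OF latticeD(1)[OF y]] and My = target[rule_format]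
  show marked: "(M *\<^sub>v y) $ (a + b + 1) = y $ 0" using r(2) latticeD(2)[OF y] by simp
  \<comment> \<open>Continuing the leg by \<open>- e1\<close> past the leaf absorbs the right hand
    side there, so the whole leg obeys the homogeneous recurrence.\<close>
  define z where "z i = (if i \<le> a then y $ i else - e1)" for i
  define w where "w j = (if j \<le> b then legB y j else - e2)" for j
  have "\<forall>i<a. z i = ks ! i * z (Suc i) - z (Suc (Suc i))"
  proof (intro allI impI)
    fix i assume i: "i < a"
    have "legA y i - ks ! i * legA y (Suc i) + legA y (Suc (Suc i)) = (if Suc i = a then e1 else 0)"
      using r(3)[OF i] My[of "Suc i"] i ab_pos by (simp add: target_def)
    then show "z i = ks ! i * z (Suc i) - z (Suc (Suc i))"
      using i by (cases "Suc i = a") (simp_all add: z_def legA_def)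
  qed
  then have "(z 0, z 1) = chain (z a) (z (Suc a)) ks"
    unfolding a_def by (rule chain_recurrence)
  then have A: "y $ 0 = y $ a * t + e1 * E" "y $ 1 = y $ a * cf_den ks + e1 * cf_coden ks"
    using ab_pos unfolding chain_lincomb[of "z a"] by (simp_all add: z_def ks(3))
  have "\<forall>j<b. w j = ls ! j * w (Suc j) - w (Suc (Suc j))"
  proof (intro allI impI)
    fix j assume j: "j < b"
    have "legB y j - ls ! j * legB y (Suc j) + legB y (Suc (Suc j)) = (if Suc j = b then e2 else 0)"
      using r(4)[OF j] My[of "a + Suc j"] j ab_pos by (simp add: target_def)
    then show "w j = ls ! j * w (Suc j) - w (Suc (Suc j))"
      using j by (cases "Suc j = b") (simp_all add: w_def legB_def)
  qed
  then have "(w 0, w 1) = chain (w b) (w (Suc b)) ls"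
    unfolding b_def by (rule chain_recurrence)
  then have B: "y $ 0 = y $ (a + b) * s + e2 * F" "legB y 1 = y $ (a + b) * cf_den ls + e2 * cf_coden ls"
    using ab_pos unfolding chain_lincomb[of "w b"] by (simp_all add: w_def legB_def ls(3))
  \<comment> \<open>The unknown value at the leaf is eliminated between the two equations of
    \<open>A\<close>; the Wronskian reduces the remaining term to \<open>e1\<close>.\<close>
  have "t * y $ 1 = cf_den ks * (y $ a * t + e1 * E) - e1 * (E * cf_den ks - cf_coden ks * t)"
    unfolding A(2) by (simp add: algebra_simps)
  then have ty: "t * y $ 1 = cf_den ks * y $ 0 - e1"
    using chain_wronskian[of ks] A(1) ks(3) by simp
  have "s * legB y 1 = cf_den ls * (y $ (a + b) * s + e2 * F) - e2 * (F * cf_den ls - cf_coden ls * s)"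
    unfolding B(2) by (simp add: algebra_simps)
  then have sy: "s * legB y 1 = cf_den ls * y $ 0 - e2"
    using chain_wronskian[of ls] B(1) ls(3) by simp
  have c: "c = - y $ 0 + y $ 1 + legB y 1"
    using r(1) My[of 0] ab_pos latticeD(2)[OF y] by (simp add: target_def legA_def)
  \<comment> \<open>The row of the centre times st. By \<open>recip\<close> the coefficient of
    \<open>y $ 0\<close> collapses to -1.\<close>
  have "s * t * c = - (s * t) * y $ 0 + s * (t * y $ 1) + t * (s * legB y 1)"
    unfolding c by (simp add: algebra_simps)
  also have "\<dots> = (s * cf_den ks + t * cf_den ls - s * t) * y $ 0 - s * e1 - t * e2"
    unfolding ty sy by (simp add: algebra_simps)
  finally have stc: "s * t * c = - y $ 0 - s * e1 - t * e2" unfolding recip by simp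
  then show "y $ 0 = - (s * t * c + s * e1 + t * e2)" by simp
  \<comment> \<open>Only the centre and the two leaves contribute: elsewhere the target is 0, except
    at the marked vertex, where y itself is 0.\<close>
  have "y \<bullet> (M *\<^sub>v y) = (\<Sum>v<a + b + 2. y $ v * (M *\<^sub>v y) $ v)"
    using carrier_vecD[OF M_mult_carrier[OF y]] unfolding scalar_prod_def lessThan_atLeast0 by simp
  also have "\<dots> = (\<Sum>v\<in>{0, a, a + b}. y $ v * target c e1 e2 v)"
  proof (rule sum.mono_neutral_cong_right)
    have "y $ v * (M *\<^sub>v y) $ v = 0" if "v < a + b + 2" "v \<notin> {0, a, a + b}" for v
    proof (cases "v = a + b + 1")
      case True
      then show ?thesis using latticeD(2)[OF y] by simp
    next
      case False
      then show ?thesis using My[of v] that by (simp add: target_def)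
    qed
    then show "\<forall>v\<in>{..<a + b + 2} - {0, a, a + b}. y $ v * (M *\<^sub>v y) $ v = 0" by blast
    show "y $ v * (M *\<^sub>v y) $ v = y $ v * target c e1 e2 v" if "v \<in> {0, a, a + b}" for v
      using My[of v] that by auto
  qed auto
  also have "\<dots> = y $ 0 * c + y $ a * e1 + y $ (a + b) * e2"
    using ab_pos by (simp add: target_def)
  finally have "s * t * (y \<bullet> (M *\<^sub>v y)) = y $ 0 * (s * t * c) + s * (e1 * (y $ a * t)) + t * (e2 * (y $ (a + b) * s))"
    by (simp add: algebra_simps)
  also have "y $ a * t = y $ 0 - e1 * E" using A(1) by simp
  also have "y $ (a + b) * s = y $ 0 - e2 * F" using B(1) by simp
  also have "e1 * (y $ 0 - e1 * E) = e1 * y $ 0 - e1 * e1 * E" by (simp add: algebra_simps)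
  also have "e2 * (y $ 0 - e2 * F) = e2 * y $ 0 - e2 * e2 * F" by (simp add: algebra_simps)
  finally show "s * t * (y \<bullet> (M *\<^sub>v y)) = - (y $ 0)\<^sup>2 - s * E - t * F"
    unfolding stc e by (simp add: algebra_simps power2_eq_square)
qed

lemma odd_s_or_t: "odd s \<or> odd t"
proof (rule ccontr)
  assume "\<not> (odd s \<or> odd t)"
  then have "even (s * cf_den ks + t * cf_den ls)" "even (s * t)" by simp_all
  then show False unfolding recip by simp
qed

lemma coprime_st: "coprime s t"
proof (rule coprimeI)
  fix d assume "d dvd s" "d dvd t"
  then have "d dvd s * t - (s * cf_den ks + t * cf_den ls)" by simp
  then show "is_unit d" unfolding recip by simp
qed

lemma self_conjugate:
  "self_conjugate_vec \<in> lattice"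
  "v < a + b + 2 \<Longrightarrow> [(M *\<^sub>v self_conjugate_vec) $ v = int (degree_at G v)] (mod 2)"
proof -
  \<comment> \<open>All three values equal to 1 match the parity of the degrees, which are odd at
    the centre and the leaves and 2 in between. The marked row is not prescribed: its entry is - (st
    + s + t), odd because s and t are not both even.\<close>
  obtain y where y: "y \<in> lattice" and target: "\<forall>v<a + b + 1. (M *\<^sub>v y) $ v = target 1 1 1 v"
    using solvable[of "target 1 1 1"] by blast
  note My = target[rule_format]
  have "[(M *\<^sub>v y) $ v = int (degree_at G v)] (mod 2)" if v: "v < a + b + 2" for v
  proof -
    consider "v < a + b + 1" | "v = a + b + 1" using v by linarith
    then show ?thesis
    proof cases
      case 1
      then show ?thesis
      proof (cases rule: vertex_cases)
        case 1
        then show ?thesis using My[of 0] by (simp add: degree_G target_def cong_def)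
      next
        case (2 i)
        then show ?thesis using My[of v] ab_pos by (simp add: degree_G target_def cong_def)
      next
        case (3 j)
        then show ?thesis using My[of v] ab_pos degree_G(4)[OF 3(1)] by (simp add: target_def cong_def)
      qed
    next
      case 2
      have "(M *\<^sub>v y) $ v = - (s * t + s + t)"
        using target_solution(1,3)[OF y target] 2 by simp
      moreover have "odd (- (s * t + s + t))" using odd_s_or_t by auto
      ultimately have "[(M *\<^sub>v y) $ v = 1] (mod 2)"
        by (simp only: cong_def odd_iff_mod_2_eq_one one_mod_two_eq_one)
      then show ?thesis unfolding 2 degree_G(2) by (simp only: of_nat_1)
    qed
  qed
  then have "\<exists>y. y \<in> unmarked_lattice \<and>
     (\<forall>v\<in>verts G. [(M *\<^sub>v y) $ v = int (degree_at G v)] (mod 2))"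
    using y by (auto simp: unmarked_lattice_eq verts_def simp del: index_mult_mat_vec)
  then have *: "self_conjugate_vec \<in> unmarked_lattice \<and>
     (\<forall>v\<in>verts G. [(M *\<^sub>v self_conjugate_vec) $ v = int (degree_at G v)] (mod 2))"
    unfolding self_conjugate_vec_def by (rule someI_ex)
  then show "self_conjugate_vec \<in> lattice" by (simp only: unmarked_lattice_eq)
  show "[(M *\<^sub>v self_conjugate_vec) $ v = int (degree_at G v)] (mod 2)" if "v < a + b + 2"
    using * that by (simp add: verts_def del: index_mult_mat_vec)
qed

definition shifted :: "int vec \<Rightarrow> int vec" where
  "shifted n = 2 \<cdot>\<^sub>v n + self_conjugate_vec"

lemma shifted_index:
  assumes "n \<in> lattice" "v < a + b + 2"
  shows "shifted n $ v = 2 * n $ v + self_conjugate_vec $ v"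
proof -
  have "dim_vec n = a + b + 2" "dim_vec self_conjugate_vec = a + b + 2"
    using latticeD(1)[OF assms(1)] latticeD(1)[OF self_conjugate(1)] by (simp_all only: carrier_vecD)
  then show ?thesis using assms(2) by (simp add: shifted_def)
qed

lemma shifted_lattice:
  assumes "n \<in> lattice"
  shows "shifted n \<in> lattice"
proof -
  have "shifted n \<in> carrier_vec (a + b + 2)"
    unfolding shifted_def using latticeD(1)[OF assms] latticeD(1)[OF self_conjugate(1)]
    by (intro add_carrier_vec smult_carrier_vec[THEN iffD2])
  moreover have "shifted n $ (a + b + 1) = 0"
    using shifted_index[OF assms, of "a + b + 1"] latticeD(2)[OF assms] latticeD(2)[OF self_conjugate(1)]
    by simp
  ultimately show ?thesis unfolding lattice_def by blast
qed

lemma shifted_inject: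
  assumes "n \<in> lattice" "n' \<in> lattice" "shifted n = shifted n'"
  shows "n = n'"
proof (rule eq_vecI)
  have dim: "dim_vec n = a + b + 2" "dim_vec n' = a + b + 2"
    using latticeD(1)[OF assms(1)] latticeD(1)[OF assms(2)] by (simp_all only: carrier_vecD)
  then show "dim_vec n = dim_vec n'" by (simp only:)
  fix v assume "v < dim_vec n'"
  then have v: "v < a + b + 2" by (simp only: dim)
  show "n $ v = n' $ v"
    using shifted_index[OF assms(1) v] shifted_index[OF assms(2) v] assms(3) by simp
qed

text \<open>Equal parities make the difference of the two images even on the unmarked vertices. By
  \<open>solvable\<close> its half is again attained on the lattice, and
  \<open>lattice_inject\<close> identifies the result.\<close>

lemma shifted_surj:
  assumes y: "y \<in> lattice"
    and par: "\<And>v. v < a + b + 1 \<Longrightarrow> [(M *\<^sub>v y) $ v = int (degree_at G v)] (mod 2)"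
  shows "\<exists>n\<in>lattice. shifted n = y"
proof -
  let ?b = self_conjugate_vec
  note b = self_conjugate(1)
  obtain n where n: "n \<in> lattice"
    and Mn: "\<And>v. v < a + b + 1 \<Longrightarrow> (M *\<^sub>v n) $ v = ((M *\<^sub>v y) $ v - (M *\<^sub>v ?b) $ v) div 2"
    using solvable[of "\<lambda>v. ((M *\<^sub>v y) $ v - (M *\<^sub>v ?b) $ v) div 2"] by blast
  have nn: "n + n \<in> carrier_vec (a + b + 2)" using n by (simp add: lattice_def)
  have "2 \<cdot>\<^sub>v n = n + n" by (intro eq_vecI) simp_all
  then have Ms: "M *\<^sub>v shifted n = M *\<^sub>v n + M *\<^sub>v n + M *\<^sub>v ?b"
    unfolding shifted_def
    by (simp only: mult_add_distrib_mat_vec[OF M_carrier nn latticeD(1)[OF b]]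
      mult_add_distrib_mat_vec[OF M_carrier latticeD(1)[OF n] latticeD(1)[OF n]])
  have "shifted n = y"
  proof (rule lattice_inject[OF shifted_lattice[OF n] y])
    fix v assume v: "v < a + b + 1"
    have "(M *\<^sub>v shifted n) $ v = 2 * (M *\<^sub>v n) $ v + (M *\<^sub>v ?b) $ v"
      unfolding Ms using v carrier_vecD[OF M_mult_carrier[OF b]] carrier_vecD[OF M_mult_carrier[OF n]]
      by (simp del: index_mult_mat_vec dim_mult_mat_vec)
    moreover have "even ((M *\<^sub>v y) $ v - (M *\<^sub>v ?b) $ v)"
      using par[OF v] self_conjugate(2)[of v] v by (metis cong_iff_dvd_diff cong_sym cong_trans
          less_Suc_eq add_Suc_right one_add_one plus_1_eq_Suc)
    ultimately show "(M *\<^sub>v shifted n) $ v = (M *\<^sub>v y) $ v" unfolding Mn[OF v] by simp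
  qed
  then show ?thesis using n by blast
qed

definition weight :: "int vec \<Rightarrow> rat" where
  "weight y = (\<Prod>v<a + b + 1. pv_const_coeff (2 - int (degree_at G v)) ((M *\<^sub>v y) $ v))"

text \<open>The exponent 2 - deg is -1 at the centre, 1 at the leaves and 0 inside the legs. The
  three evaluations of \<open>pv_const_coeff\<close> give the respective supports: odd numbers, 1
  and -1, and 0.\<close>

lemma weight_nonzeroE:
  assumes "weight y \<noteq> 0"
  obtains c e1 e2 where "odd c" "e1 = 1 \<or> e1 = - 1" "e2 = 1 \<or> e2 = - 1"
    "\<forall>v<a + b + 1. (M *\<^sub>v y) $ v = target c e1 e2 v"
proof -
  define l where "l v = (M *\<^sub>v y) $ v" for v
  have nz: "pv_const_coeff (2 - int (degree_at G v)) (l v) \<noteq> 0" if "v < a + b + 1" for v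
  proof
    assume "pv_const_coeff (2 - int (degree_at G v)) (l v) = 0"
    then have "weight y = 0" unfolding weight_def l_def
      using that by (intro prod_zero bexI[of _ v]) simp_all
    then show False using assms by simp
  qed
  have "odd (l 0)" using nz[of 0] by (auto simp: degree_G(1) pv_const_coeff_m1 split: if_splits)
  moreover have "l a = 1 \<or> l a = - 1"
    using nz[of a] degree_G(3)[of "a - 1"] ab_pos by (auto simp: pv_const_coeff_1 split: if_splits)
  moreover have "l (a + b) = 1 \<or> l (a + b) = - 1"
    using nz[of "a + b"] degree_G(4)[of "b - 1"] ab_pos by (auto simp: pv_const_coeff_1 split: if_splits)
  moreover have "l v = target (l 0) (l a) (l (a + b)) v" if "v < a + b + 1" for v
    using that
  proof (cases rule: vertex_cases)
    case (2 i)
    then show ?thesis using nz[OF that] ab_pos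
      by (cases "Suc i = a") (auto simp: degree_G(3) target_def pv_const_coeff_0 split: if_splits)
  next
    case (3 j)
    then show ?thesis using nz[OF that] ab_pos degree_G(4)[OF 3(1)]
      by (cases "Suc j = b") (auto simp: target_def pv_const_coeff_0 split: if_splits)
  qed (simp add: target_def)
  ultimately show thesis using that unfolding l_def by blast
qed

lemma weight_target:
  assumes "odd c" "e1 = 1 \<or> e1 = - 1" "e2 = 1 \<or> e2 = - 1"
    and My: "\<forall>v<a + b + 1. (M *\<^sub>v y) $ v = target c e1 e2 v"
  shows "weight y = of_int (sgn c * e1 * e2) / 2"
proof -
  let ?g = "\<lambda>v. pv_const_coeff (2 - int (degree_at G v)) (target c e1 e2 v)"
  have "weight y = (\<Prod>v<a + b + 1. ?g v)"
    unfolding weight_def by (intro prod.cong refl) (simp add: My[rule_format] del: index_mult_mat_vec)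
  also have "\<dots> = (\<Prod>v\<in>{0, a, a + b}. ?g v)"
  proof (rule prod.mono_neutral_right)
    have "?g v = 1" if "v < a + b + 1" "v \<notin> {0, a, a + b}" for v
      using that(1)
    proof (cases rule: vertex_cases)
      case 1
      then show ?thesis using that by simp
    next
      case (2 i)
      then show ?thesis using that degree_G(3)[OF 2(1)] by (simp add: target_def pv_const_coeff_0)
    next
      case (3 j)
      then show ?thesis using that degree_G(4)[OF 3(1)] by (simp add: target_def pv_const_coeff_0)
    qed
    then show "\<forall>v\<in>{..<a + b + 1} - {0, a, a + b}. ?g v = 1" by blast
  qed auto
  also have "\<dots> = ?g 0 * ?g a * ?g (a + b)"
    using ab_pos by simp
  also have "?g 0 = of_int (sgn c) / 2"
    using assms(1) by (simp add: degree_G(1) target_def pv_const_coeff_m1)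
  also have "?g a = - of_int e1"
    using degree_G(3)[of "a - 1"] ab_pos assms(2) by (auto simp: target_def pv_const_coeff_1)
  also have "?g (a + b) = - of_int e2"
    using degree_G(4)[of "b - 1"] ab_pos assms(3) by (auto simp: target_def pv_const_coeff_1)
  finally show ?thesis by simp
qed

text \<open>Odd \<open>c\<close> is nonzero, and st exceeds s + t because s = t = 2 is excluded by
  parity. Hence the multiple of st dominates.\<close>

lemma sgn_odd_multiple:
  assumes "odd c" "e1 = 1 \<or> e1 = - 1" "e2 = 1 \<or> e2 = - 1"
  shows "sgn (- (s * t * c + s * e1 + t * e2)) = - sgn c"
proof -
  have "s \<noteq> 2 \<or> t \<noteq> 2" using odd_s_or_t by auto
  then have "(s - 1) * (t - 1) \<ge> 2"
    using s t mult_mono[of 2 "s - 1" 1 "t - 1"] mult_mono[of 1 "s - 1" 2 "t - 1"] by (cases "s = 2") auto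
  then have big: "s * t > s + t" by (simp add: algebra_simps)
  have small: "\<bar>s * e1 + t * e2\<bar> \<le> s + t" using assms(2,3) s t by auto
  consider "c \<ge> 1" | "c \<le> - 1" using assms(1) by (cases c "0 :: int" rule: linorder_cases) auto
  then show ?thesis
  proof cases
    case 1
    then have "s * t * c \<ge> s * t * 1" using s t by (intro mult_left_mono) auto
    then show ?thesis using big small 1 by (auto simp: sgn_if)
  next
    case 2
    then have "s * t * c \<le> s * t * (- 1)" using s t by (intro mult_left_mono) auto
    then show ?thesis using big small 2 by (auto simp: sgn_if)
  qed
qed

definition q_prefactor :: rat where
  "q_prefactor = of_int (3 * matrix_signature (map_mat real_of_int M) - sum_list (weights G)) / 4"

text \<open>The signature is -(a + b + 1). Its triple assigns -3 to each leg vertex, matching the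
  summands of \<open>blow_down_identity\<close>; the centre gives -3 + 1 = -2 and the marked vertex
  gives st.\<close>

lemma q_prefactor_eq:
  "q_prefactor = (of_int ((sum_list ks - 3 * int a) + (sum_list ls - 3 * int b)) - 2 + of_int (s * t)) / 4"
proof -
  have "det (reduced_matrix G) \<noteq> 0" using abs_det_reduced by auto
  then have "matrix_signature (map_mat real_of_int M) = - int (a + b + 1)"
    using eigenvalue_counts by (simp add: matrix_signature_def)
  then show ?thesis unfolding q_prefactor_def sum_list_weights_G by simp
qed

lemma F_K_eq:
  "F_K = q_shift q_prefactor (formal_sum lattice (\<lambda>n. xq_scale (weight (shifted n))
     (xq_monom (of_int ((M *\<^sub>v shifted n) $ (a + b + 1)) / 2)
       (- of_int (shifted n \<bullet> (M *\<^sub>v shifted n)) / 4))))"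
proof -
  have "det (reduced_matrix G) \<noteq> 0" using abs_det_reduced by auto
  then have pos: "num_pos_eigenvalues (map_mat real_of_int M) = 0" by (rule eigenvalue_counts)
  have verts: "verts G - {marked G} = {..<a + b + 1}" by (auto simp: verts_def)
  show ?thesis
    unfolding F_K_def Let_def pos unmarked_lattice_eq shifted_def[symmetric] q_prefactor_def[symmetric]
      verts weight_def[symmetric]
    unfolding marked_G by (simp add: xq_scale_def[of 1])
qed

lemma nonzero_weight:
  assumes y: "y \<in> lattice" and w: "weight y \<noteq> 0"
  shows "(M *\<^sub>v y) $ (a + b + 1) = y $ 0"
    and "- of_int (y \<bullet> (M *\<^sub>v y)) / 4 + q_prefactor = torus_exponent s t (y $ 0)"
    and "weight y = torus_coeff s t (y $ 0)"
proof -
  obtain c e1 e2 where c: "odd c" "e1 = 1 \<or> e1 = - 1" "e2 = 1 \<or> e2 = - 1"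
    and My: "\<forall>v<a + b + 1. (M *\<^sub>v y) $ v = target c e1 e2 v"
    by (rule weight_nonzeroE[OF w]) (rule that)
  have e: "e1 * e1 = 1" "e2 * e2 = 1" using c by auto
  note sol = target_solution[OF y My e]
  show "(M *\<^sub>v y) $ (a + b + 1) = y $ 0" by (rule sol(3))
  \<comment> \<open>Both \<open>sgn\<close> and \<open>torus_eps\<close> at \<open>y $ 0\<close>
    contribute a minus sign, and these cancel.\<close>
  show "weight y = torus_coeff s t (y $ 0)"
    unfolding weight_target[OF c My] torus_coeff_def sol(1) sgn_odd_multiple[OF c]
      torus_eps_odd_multiple[OF s t c] by simp
  define X :: rat where "X = of_int ((sum_list ks - 3 * int a) + (sum_list ls - 3 * int b))"
  have "X + (of_int E + of_int s) / of_int t + (of_int F + of_int t) / of_int s = 2"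
    using blow_down_identity[OF ks(2) ls(2)] recip
    unfolding ks(3) ls(3) sum_list_of_int_minus_3 X_def a_def b_def by simp
  moreover have "of_int s * of_int t * of_int (y \<bullet> (M *\<^sub>v y)) =
      - (of_int (y $ 0))\<^sup>2 - of_int s * of_int E - of_int t * (of_int F :: rat)"
    using arg_cong[OF sol(2), of "of_int :: int \<Rightarrow> rat"]
    by (simp only: of_int_mult of_int_diff of_int_minus of_int_power)
  ultimately have "- of_int (y \<bullet> (M *\<^sub>v y)) / 4 + (X - 2 + of_int s * of_int t) / 4 =
      ((of_int (y $ 0))\<^sup>2 - (of_int s * of_int t - of_int s - of_int t)\<^sup>2) / (4 * of_int s * of_int t)
      + (of_int s - 1) * (of_int t - 1) / (2 :: rat)"
    using s t by (intro exponent_identity) auto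
  then show "- of_int (y \<bullet> (M *\<^sub>v y)) / 4 + q_prefactor = torus_exponent s t (y $ 0)"
    unfolding q_prefactor_eq X_def[symmetric] torus_exponent_def of_int_mult of_int_diff of_int_power of_int_1
      of_int_numeral .
qed

lemma weight_support_inject:
  assumes "y \<in> lattice" "y' \<in> lattice" "weight y \<noteq> 0" "weight y' \<noteq> 0" "y $ 0 = y' $ 0"
  shows "y = y'"
proof -
  obtain c e1 e2 where c: "odd c" "e1 = 1 \<or> e1 = - 1" "e2 = 1 \<or> e2 = - 1"
    and My: "\<forall>v<a + b + 1. (M *\<^sub>v y) $ v = target c e1 e2 v"
    by (rule weight_nonzeroE[OF assms(3)]) (rule that)
  obtain c' e1' e2' where c': "odd c'" "e1' = 1 \<or> e1' = - 1" "e2' = 1 \<or> e2' = - 1"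
    and My': "\<forall>v<a + b + 1. (M *\<^sub>v y') $ v = target c' e1' e2' v"
    by (rule weight_nonzeroE[OF assms(4)]) (rule that)
  have "e1 * e1 = 1" "e2 * e2 = 1" "e1' * e1' = 1" "e2' * e2' = 1" using c c' by auto
  then have "s * t * c + s * e1 + t * e2 = s * t * c' + s * e1' + t * e2'"
    using target_solution(1)[OF assms(1) My] target_solution(1)[OF assms(2) My'] assms(5) by simp
  then have "c = c' \<and> e1 = e1' \<and> e2 = e2'"
    by (rule odd_multiple_unique[OF s t coprime_st c(1) c'(1) c(2,3) c'(2,3)])
  then show ?thesis using My My' by (intro lattice_inject[OF assms(1,2)]) (simp only: simp_thms)
qed

lemma weight_support_surj:
  assumes "torus_eps s t z \<noteq> 0"
  obtains n where "n \<in> lattice" "weight (shifted n) \<noteq> 0" "shifted n $ 0 = z"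
proof -
  obtain c e1 e2 where c: "odd c" "e1 = 1 \<or> e1 = - 1" "e2 = 1 \<or> e2 = - 1"
    and z: "z = - (s * t * c + s * e1 + t * e2)"
    by (rule torus_eps_nonzeroE[OF assms]) (rule that)
  obtain y where y: "y \<in> lattice" and My: "\<forall>v<a + b + 1. (M *\<^sub>v y) $ v = target c e1 e2 v"
    using solvable[of "target c e1 e2"] by blast
  have e: "e1 * e1 = 1" "e2 * e2 = 1" using c by auto
  have "weight y \<noteq> 0"
    unfolding weight_target[OF c My] using c by (auto simp: sgn_if elim: oddE)
  moreover have "y $ 0 = z" using target_solution(1)[OF y My e] z by simp
  moreover have "\<exists>n\<in>lattice. shifted n = y"
  proof (rule shifted_surj[OF y])
    fix v assume v: "v < a + b + 1"
    have odd: "odd e1" "odd e2" using c by auto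
    have "[target c e1 e2 v = int (degree_at G v)] (mod 2)"
      using v
    proof (cases rule: vertex_cases)
      case 1
      then show ?thesis using c(1) by (simp add: degree_G(1) target_def cong_def odd_iff_mod_2_eq_one)
    next
      case (2 i)
      then show ?thesis using odd ab_pos degree_G(3)[OF 2(1)]
        by (auto simp: target_def cong_def odd_iff_mod_2_eq_one)
    next
      case (3 j)
      then show ?thesis using odd ab_pos degree_G(4)[OF 3(1)]
        by (auto simp: target_def cong_def odd_iff_mod_2_eq_one)
    qed
    then show "[(M *\<^sub>v y) $ v = int (degree_at G v)] (mod 2)"
      by (simp only: My[rule_format, OF v])
  qed
  ultimately show thesis using that by blast
qed

text \<open>A coefficient can be nonzero only at a pair (z / 2,
  \<open>torus_exponent s t z\<close>), where the exponent of x fixes z. If \<open>torus_eps\<close>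
  vanishes at z, no lattice vector contributes; otherwise exactly one does.\<close>

lemma F_K_eq_torus_series: "F_K = torus_series s t"
proof (intro ext)
  fix x e :: rat
  define f where "f n = xq_scale (weight (shifted n))
     (xq_monom (of_int ((M *\<^sub>v shifted n) $ (a + b + 1)) / 2)
       (- of_int (shifted n \<bullet> (M *\<^sub>v shifted n)) / 4))" for n
  have FK: "F_K x e = formal_sum lattice f x (e - q_prefactor)"
    unfolding F_K_eq q_shift_def f_def ..
  have f: "f n x (e - q_prefactor) =
      (if x = of_int (shifted n $ 0) / 2 \<and> e = torus_exponent s t (shifted n $ 0) then weight (shifted n) else 0)"
    if "n \<in> lattice" for n
  proof (cases "weight (shifted n) = 0")
    case True
    then show ?thesis by (simp add: f_def xq_scale_def)
  next
    case False
    note nz = nonzero_weight[OF shifted_lattice[OF that] False]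
    have "e - q_prefactor = - of_int (shifted n \<bullet> (M *\<^sub>v shifted n)) / 4 \<longleftrightarrow> e = torus_exponent s t (shifted n $ 0)"
      unfolding nz(2)[symmetric] by (simp only: diff_eq_eq)
    then show ?thesis unfolding f_def xq_scale_def xq_monom_def nz(1) by simp
  qed
  have fz: "x = of_int (shifted n $ 0) / 2 \<and> e = torus_exponent s t (shifted n $ 0) \<and>
      weight (shifted n) \<noteq> 0" if "n \<in> lattice" "f n x (e - q_prefactor) \<noteq> 0" for n
    using f[OF that(1)] that(2) by (simp split: if_splits)
  show "F_K x e = torus_series s t x e"
  proof (cases "\<exists>z. x = of_int z / 2 \<and> e = torus_exponent s t z")
    case True
    then obtain z where z: "x = of_int z / 2" "e = torus_exponent s t z" by blast
    have fz': "shifted n $ 0 = z \<and> weight (shifted n) \<noteq> 0" if "n \<in> lattice" "f n x (e - q_prefactor) \<noteq> 0" for n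
      using fz[OF that] z(1) by simp
    have "F_K x e = torus_coeff s t z"
    proof (cases "torus_eps s t z = 0")
      case True
      have "formal_sum lattice f x (e - q_prefactor) = 0"
      proof (rule formal_sum_zero, rule ccontr)
        fix n assume "n \<in> lattice" "f n x (e - q_prefactor) \<noteq> 0"
        then have "torus_coeff s t z \<noteq> 0"
          using fz' nonzero_weight(3)[OF shifted_lattice] by metis
        then show False using True by (simp add: torus_coeff_def)
      qed
      then show ?thesis using FK True by (simp add: torus_coeff_def)
    next
      case False
      obtain n where n: "n \<in> lattice" "weight (shifted n) \<noteq> 0" "shifted n $ 0 = z"
        by (rule weight_support_surj[OF False]) (rule that)
      have "x = of_int (shifted n $ 0) / 2 \<and> e = torus_exponent s t (shifted n $ 0)"
        unfolding n(3) using z by (rule conjI)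
      then have fn: "f n x (e - q_prefactor) = weight (shifted n)"
        using f[OF n(1)] by (simp only: simp_thms if_True)
      have "formal_sum lattice f x (e - q_prefactor) = f n x (e - q_prefactor)"
      proof (rule formal_sum_single[OF n(1)], rule ccontr)
        fix n' assume n': "n' \<in> lattice" "n' \<noteq> n" "f n' x (e - q_prefactor) \<noteq> 0"
        have "shifted n' = shifted n"
          using fz'[OF n'(1,3)] n shifted_lattice n'(1) by (intro weight_support_inject) auto
        then show False using shifted_inject n'(1,2) n(1) by blast
      qed
      also note fn
      also have "weight (shifted n) = torus_coeff s t z"
        using nonzero_weight(3)[OF shifted_lattice[OF n(1)] n(2)] n(3) by simp
      finally show ?thesis using FK by simp
    qed
    then show ?thesis by (simp only: z torus_series_coeff)
  next
    case False
    have "formal_sum lattice f x (e - q_prefactor) = 0"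
      by (rule formal_sum_zero) (use fz False in blast)
    moreover have "torus_series s t x e = 0" using False by (intro torus_series_eq_0) blast
    ultimately show ?thesis using FK by simp
  qed
qed

end

theorem theorem1p3:
  fixes s t :: int
  assumes "s > 1" and "t > 1" and "gcd s t = 1"
  shows "plumbed_knot.F_K (torus_knot_plumbing s t) =
    q_shift (of_int ((s - 1) * (t - 1)) / 2)
      (xq_scale (1 / 2)
        (formal_sum {m. m \<ge> 1} (\<lambda>m.
          xq_scale (torus_eps s t m)
            (xq_monom (of_int m / 2)
               (of_int (m\<^sup>2 - (s * t - s - t)\<^sup>2) / of_int (4 * s * t))
             - xq_monom (- (of_int m / 2))
               (of_int (m\<^sup>2 - (s * t - s - t)\<^sup>2) / of_int (4 * s * t))))))"
proof -
  define t' s' where "t' = neg_inverse_mod s t" and "s' = neg_inverse_mod t s"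
  define ks ls where "ks = neg_cf_expansion (of_int t / of_int t')"
    and "ls = neg_cf_expansion (of_int s / of_int s')"
  have gcd: "gcd t s = 1" using assms(3) by (simp add: gcd.commute)
  have recip: "s * t' + t * s' = s * t - 1"
    unfolding t'_def s'_def by (rule neg_inverse_mod_reciprocity[OF assms])
  have "coprime t t'" "coprime s s'"
  proof -
    show "coprime t t'"
    proof (rule coprimeI)
      fix d assume "d dvd t" "d dvd t'"
      then have "d dvd s * t - (s * t' + t * s')" by simp
      then show "is_unit d" unfolding recip by simp
    qed
    show "coprime s s'"
    proof (rule coprimeI)
      fix d assume "d dvd s" "d dvd s'"
      then have "d dvd s * t - (s * t' + t * s')" by simp
      then show "is_unit d" unfolding recip by simp
    qed
  qed
  note ks = neg_cf_expansion_eq[OF neg_inverse_mod_props(1,2)[OF assms(2,3)]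
      \<open>coprime t t'\<close>[unfolded t'_def], folded t'_def, folded ks_def]
    and ls = neg_cf_expansion_eq[OF neg_inverse_mod_props(1,2)[OF assms(1) gcd]
      \<open>coprime s s'\<close>[unfolded s'_def], folded s'_def, folded ls_def]
  interpret torus_legs s t ks ls
    by unfold_locales (use assms ks ls recip in simp_all)
  have "torus_knot_plumbing s t = G"
    unfolding torus_knot_plumbing_def Let_def t'_def[symmetric] s'_def[symmetric]
      ks_def[symmetric] ls_def[symmetric] a_def[symmetric] b_def[symmetric] G_def ..
  then show ?thesis using F_K_eq_torus_series unfolding torus_series_def by simp
qed

end
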